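(* Let $F_7$ be the $4$-graph on $\{1,\dots,7\}$ with edges $\{1234,1235,1236,4567\}$. There exist constants $N_0$ and $c>0$ such that for all integers $n\ge N_0$ and all integers $t\in[0,cn]$ we have \[ \mathrm{EX}\left(n,(t+1)F_7\right)=\{K_t^4\bowtie B^{\mathrm{even}}_4(n-t)\}. \]
   Context: $B^{\mathrm{even}}_4(n)$ is the $4$-graph on $n$ vertices obtained from a partition $V_1\cup V_2$ of the vertex set by taking as edges all $4$-sets with exactly two vertices in each part, where the partition is chosen to maximize the number of edges. $K_t^4$ is the complete $4$-graph on $t$ vertices; for $4$-graphs on disjoint vertex sets, $\mathcal{G}\bowtie\mathcal{H}$ consists of the edges of both plus all $4$-subsets meeting both vertex sets. $\mathrm{EX}(n,(t+1)F)$ is the set (up to isomorphism) of $n$-vertex $4$-graphs not containing $t+1$ pairwise vertex-disjoint copies of $F$ with the maximum number of edges among such. *)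

theory Defs
  imports Complex_Main "HOL-Library.Disjoint_Sets"
begin

record 'a hypergraph =
  verts :: "'a set"
  edges :: "'a set set"

definition four_graph :: "'a hypergraph \<Rightarrow> bool" where
  "four_graph G \<longleftrightarrow> finite (verts G) \<and> edges G \<subseteq> {e. e \<subseteq> verts G \<and> card e = 4}"

definition hg_iso :: "'a hypergraph \<Rightarrow> 'b hypergraph \<Rightarrow> bool" (infix "\<cong>\<^sub>h" 50) where
  "G \<cong>\<^sub>h H \<longleftrightarrow> (\<exists>f. bij_betw f (verts G) (verts H) \<and> edges H = (\<lambda>e. f ` e) ` edges G)"

definition iso_rel :: "('a hypergraph \<times> 'a hypergraph) set" where
  "iso_rel = {(G, H). four_graph G \<and> four_graph H \<and> G \<cong>\<^sub>h H}"

text \<open>A copy of \<open>F\<close> in \<open>G\<close> is a subgraph of \<open>G\<close>, not necessarily induced, that is isomorphic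
  to \<open>F\<close>.\<close>

definition is_copy_in :: "'b hypergraph \<Rightarrow> 'a hypergraph \<Rightarrow> 'a hypergraph \<Rightarrow> bool" where
  "is_copy_in F G C \<longleftrightarrow> verts C \<subseteq> verts G \<and> edges C \<subseteq> edges G \<and> F \<cong>\<^sub>h C"

definition has_disjoint_copies :: "nat \<Rightarrow> 'b hypergraph \<Rightarrow> 'a hypergraph \<Rightarrow> bool" where
  "has_disjoint_copies k F G \<longleftrightarrow>
     (\<exists>C. (\<forall>i<k. is_copy_in F G (C i)) \<and> disjoint_family_on (\<lambda>i. verts (C i)) {..<k})"

text \<open>\<open>EX_classes n k F\<close> is the set of isomorphism classes written $\mathrm{EX}(n, kF)$. Since the
  vertices may be any \<open>n\<close> natural numbers, every finite \<open>n\<close>-vertex 4-graph is represented.\<close>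

definition EX_classes :: "nat \<Rightarrow> nat \<Rightarrow> 'b hypergraph \<Rightarrow> nat hypergraph set set" where
  "EX_classes n k F =
     {G. is_arg_max (\<lambda>H. card (edges H))
           (\<lambda>H. four_graph H \<and> card (verts H) = n \<and> \<not> has_disjoint_copies k F H) G} // iso_rel"

definition complete4 :: "'a set \<Rightarrow> 'a hypergraph" where
  "complete4 V = \<lparr>verts = V, edges = {e. e \<subseteq> V \<and> card e = 4}\<rparr>"

text \<open>The join is only meant for 4-graphs with disjoint vertex sets.\<close>

definition join4 :: "'a hypergraph \<Rightarrow> 'a hypergraph \<Rightarrow> 'a hypergraph" (infixl "\<bowtie>" 65) where
  "G \<bowtie> H = \<lparr>verts = verts G \<union> verts H,
     edges = edges G \<union> edges H \<union>
       {e. e \<subseteq> verts G \<union> verts H \<and> card e = 4 \<and> e \<inter> verts G \<noteq> {} \<and> e \<inter> verts H \<noteq> {}}\<rparr>"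

definition two_two_graph :: "'a set \<Rightarrow> 'a set \<Rightarrow> 'a hypergraph" where
  "two_two_graph V1 V2 = \<lparr>verts = V1 \<union> V2,
     edges = {e. e \<subseteq> V1 \<union> V2 \<and> card (e \<inter> V1) = 2 \<and> card (e \<inter> V2) = 2}\<rparr>"

text \<open>\<open>B4_even V\<close> is $B^{\mathrm{even}}_4(n)$ for \<open>n = card V\<close>, placed on the vertex set \<open>V\<close>.
  For finite \<open>V\<close> an optimal partition exists, and all optimal partitions give isomorphic
  graphs, so the choice made by \<open>ARG_MAX\<close> is immaterial.\<close>

definition B4_even :: "'a set \<Rightarrow> 'a hypergraph" where
  "B4_even V =
     (let V1 = (ARG_MAX (\<lambda>A. card (edges (two_two_graph A (V - A)))) A. A \<subseteq> V)
      in two_two_graph V1 (V - V1))"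

definition F7 :: "nat hypergraph" where
  "F7 = \<lparr>verts = {1..7}, edges = {{1,2,3,4}, {1,2,3,5}, {1,2,3,6}, {4,5,6,7}}\<rparr>"

end

theory Submission
  imports Defs
begin

text \<open>
  For a triple \<open>T\<close> of an \<open>F\<^sub>7\<close>-free 4-graph, an edge containing three vertices of the neighbourhood of
  \<open>T\<close> must meet \<open>T\<close>, so only \<open>O(n\<^sup>3)\<close> edges have three vertices in that neighbourhood. Let \<open>A\<close> be a
  largest neighbourhood of a triple and let \<open>B\<close> be the largest set \<open>N(T) - A\<close> over the triples \<open>T\<close> with
  exactly two vertices in \<open>A\<close>. Bounding the codegree of each triple according to its position relative
  to \<open>A\<close> and \<open>B\<close> gives at most \<open>n\<^sup>4/64 + O(n\<^sup>3)\<close> edges, and near-equality forces \<open>A\<close> and \<open>B\<close> to have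
  almost \<open>n/2\<close> vertices each, so that almost all edges have two vertices in \<open>A\<close>.

  An extremal graph without \<open>t + 1\<close> disjoint copies of \<open>F\<^sub>7\<close> becomes \<open>F\<^sub>7\<close>-free after deletion of \<open>7t\<close>
  vertices, hence it has a cut for which few 2-2 sets are missing. Take a maximum cut. A vertex lying in
  many edges that are not 2-2 is in a copy of \<open>F\<^sub>7\<close> avoiding any prescribed small set, and so is
  every non-2-2 edge all of whose vertices have small missing degree. Hence at most \<open>t\<close> such vertices
  and edges are pairwise disjoint. Let \<open>L\<close> be the set of these vertices. Comparing with the graph of all
  4-sets that meet a \<open>t\<close>-set \<open>K\<close> containing \<open>L\<close> or are 2-2 shows that \<open>L\<close> has exactly \<open>t\<close> vertices and
  that the two graphs coincide.
\<close>

section \<open>Counting sets and codegrees\<close>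

definition nset :: "'a set \<Rightarrow> nat \<Rightarrow> 'a set set" where
  "nset V k = {e. e \<subseteq> V \<and> card e = k}"

definition nbr :: "'a set set \<Rightarrow> 'a set \<Rightarrow> 'a set" where
  "nbr E T = {x. x \<notin> T \<and> insert x T \<in> E}"

lemma nset_finite [simp]: "finite V \<Longrightarrow> finite (nset V k)"
  unfolding nset_def by (rule finite_subset[of _ "Pow V"]) auto

lemma nset_mem_finite: "finite V \<Longrightarrow> e \<in> nset V k \<Longrightarrow> finite e"
  unfolding nset_def using finite_subset by auto

lemma nset_mono: "V \<subseteq> W \<Longrightarrow> nset V k \<subseteq> nset W k"
  unfolding nset_def by auto

lemma card_nset: "finite V \<Longrightarrow> card (nset V k) = card V choose k"
  unfolding nset_def by (rule n_subsets)

lemma binomial_le_power: "n choose k \<le> n ^ k"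
  by (cases "k \<le> n") (auto simp: binomial_le_pow binomial_eq_0)

text \<open>Deleting \<open>P\<close> sends these sets injectively to sets of size
  \<open>k - card P\<close>. Crude powers suffice because such counts only bound exceptional
  families.\<close>

lemma card_nset_superset_le:
  assumes V: "finite V" and P: "finite P"
  shows "card {e \<in> nset V k. P \<subseteq> e} \<le> card V ^ (k - card P)"
proof -
  have "inj_on (\<lambda>e. e - P) {e \<in> nset V k. P \<subseteq> e}"
    by (rule inj_onI) auto
  moreover have "(\<lambda>e. e - P) ` {e \<in> nset V k. P \<subseteq> e} \<subseteq> nset V (k - card P)"
    using P by (auto simp: nset_def card_Diff_subset)
  ultimately have "card {e \<in> nset V k. P \<subseteq> e} \<le> card (nset V (k - card P))"
    using V by (meson card_inj_on_le nset_finite)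
  also have "\<dots> \<le> card V ^ (k - card P)"
    using V by (simp add: card_nset binomial_le_power)
  finally show ?thesis .
qed

lemma card_nset_meet_le:
  assumes V: "finite V" and X: "finite X"
  shows "card {e \<in> nset V k. e \<inter> X \<noteq> {}} \<le> card X * card V ^ (k - 1)"
proof -
  have "{e \<in> nset V k. e \<inter> X \<noteq> {}} \<subseteq> (\<Union>x\<in>X. {e \<in> nset V k. {x} \<subseteq> e})"
    by auto
  then have "card {e \<in> nset V k. e \<inter> X \<noteq> {}} \<le> card (\<Union>x\<in>X. {e \<in> nset V k. {x} \<subseteq> e})"
    using V X by (intro card_mono) auto
  also have "\<dots> \<le> (\<Sum>x\<in>X. card {e \<in> nset V k. {x} \<subseteq> e})"
    using X by (rule card_UN_le)
  also have "\<dots> \<le> (\<Sum>x\<in>X. card V ^ (k - 1))"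
    using card_nset_superset_le[OF V, of "{_}" k] by (intro sum_mono) auto
  finally show ?thesis by simp
qed

lemma card_nset_star_meet_le:
  assumes V: "finite V" and X: "finite X" "v \<notin> X"
  shows "card {e \<in> nset V k. v \<in> e \<and> e \<inter> X \<noteq> {}} \<le> card X * card V ^ (k - 2)"
proof -
  have "{e \<in> nset V k. v \<in> e \<and> e \<inter> X \<noteq> {}} \<subseteq> (\<Union>x\<in>X. {e \<in> nset V k. {v, x} \<subseteq> e})"
    by auto
  then have "card {e \<in> nset V k. v \<in> e \<and> e \<inter> X \<noteq> {}} \<le> card (\<Union>x\<in>X. {e \<in> nset V k. {v, x} \<subseteq> e})"
    using V X by (intro card_mono) auto
  also have "\<dots> \<le> (\<Sum>x\<in>X. card {e \<in> nset V k. {v, x} \<subseteq> e})"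
    using X by (intro card_UN_le) auto
  also have "\<dots> \<le> (\<Sum>x\<in>X. card V ^ (k - 2))"
  proof (rule sum_mono)
    fix x assume "x \<in> X"
    then have "v \<noteq> x" using X by auto
    then have "card {v, x} = 2" by simp
    then show "card {e \<in> nset V k. {v, x} \<subseteq> e} \<le> card V ^ (k - 2)"
      using card_nset_superset_le[OF V, of "{v, x}" k] by simp
  qed
  finally show ?thesis by simp
qed

lemma card_split_sets:
  assumes V: "finite V" and A: "A \<subseteq> V"
  shows "card {T. T \<subseteq> V \<and> card (T \<inter> A) = i \<and> card (T - A) = j} =
    (card A choose i) * (card (V - A) choose j)"
proof -
  have "bij_betw (\<lambda>T. (T \<inter> A, T - A)) {T. T \<subseteq> V \<and> card (T \<inter> A) = i \<and> card (T - A) = j}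
      (nset A i \<times> nset (V - A) j)"
  proof (rule bij_betw_byWitness[where f' = "\<lambda>(X, Y). X \<union> Y"])
    show "(\<lambda>(X, Y). X \<union> Y) ` (nset A i \<times> nset (V - A) j)
        \<subseteq> {T. T \<subseteq> V \<and> card (T \<inter> A) = i \<and> card (T - A) = j}"
    proof clarsimp
      fix X Y assume "X \<in> nset A i" "Y \<in> nset (V - A) j"
      moreover from this have "(X \<union> Y) \<inter> A = X" "(X \<union> Y) - A = Y"
        by (auto simp: nset_def)
      ultimately show "X \<subseteq> V \<and> Y \<subseteq> V \<and> card ((X \<union> Y) \<inter> A) = i \<and> card (X \<union> Y - A) = j"
        using A by (auto simp: nset_def)
    qed
  qed (use A in \<open>auto simp: nset_def\<close>)
  then show ?thesis
    using V A by (simp add: bij_betw_same_card card_cartesian_product card_nset finite_subset)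
qed

lemma card_split: "finite T \<Longrightarrow> card T = card (T \<inter> A) + card (T - A)"
  by (metis Diff_Diff_Int Diff_subset Int_Diff_Un Int_Diff_disjoint card_Un_disjoint finite_Diff finite_Int)

lemma card_nset_split:
  assumes V: "finite V" and A: "A \<subseteq> V" and "i \<le> k"
  shows "card {e \<in> nset V k. card (e \<inter> A) = i} = (card A choose i) * (card (V - A) choose (k - i))"
proof -
  have "{e \<in> nset V k. card (e \<inter> A) = i} = {T. T \<subseteq> V \<and> card (T \<inter> A) = i \<and> card (T - A) = k - i}"
  proof (intro set_eqI iffI)
    fix x
    assume x: "x \<in> {e \<in> nset V k. card (e \<inter> A) = i}"
    then have "finite x" using V by (auto simp: nset_def finite_subset)
    from card_split[OF this, of A] x show "x \<in> {T. T \<subseteq> V \<and> card (T \<inter> A) = i \<and> card (T - A) = k - i}"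
      by (auto simp: nset_def)
  next
    fix x
    assume x: "x \<in> {T. T \<subseteq> V \<and> card (T \<inter> A) = i \<and> card (T - A) = k - i}"
    then have "finite x" using V by (auto simp: finite_subset)
    from card_split[OF this, of A] x \<open>i \<le> k\<close> show "x \<in> {e \<in> nset V k. card (e \<inter> A) = i}"
      by (auto simp: nset_def)
  qed
  then show ?thesis using card_split_sets[OF V A] by simp
qed

section \<open>Double counting with codegrees of triples\<close>

lemma card_nbr:
  assumes "E \<subseteq> nset V 4" "card T = 3"
  shows "card (nbr E T) = card {e \<in> E. T \<subseteq> e}"
proof -
  have T: "finite T" using assms(2) by (metis card.infinite zero_neq_numeral)
  have "bij_betw (\<lambda>x. insert x T) (nbr E T) {e \<in> E. T \<subseteq> e}"
    unfolding bij_betw_def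
  proof
    show "inj_on (\<lambda>x. insert x T) (nbr E T)"
      by (rule inj_onI) (auto simp: nbr_def)
    show "(\<lambda>x. insert x T) ` nbr E T = {e \<in> E. T \<subseteq> e}"
    proof
      show "{e \<in> E. T \<subseteq> e} \<subseteq> (\<lambda>x. insert x T) ` nbr E T"
      proof
        fix e assume e: "e \<in> {e \<in> E. T \<subseteq> e}"
        then have "card e = 4" using assms(1) by (auto simp: nset_def)
        then have "card (e - T) = 1" using e assms(2) T by (auto simp: card_Diff_subset)
        then obtain x where "e - T = {x}" using card_1_singletonE by blast
        then have "e = insert x T" "x \<notin> T" using e by auto
        then show "e \<in> (\<lambda>x. insert x T) ` nbr E T" using e by (auto simp: nbr_def)
      qed
    qed (auto simp: nbr_def)
  qed
  then show ?thesis by (rule bij_betw_same_card)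
qed

lemma sum_card_superset:
  assumes M: "finite M" "M \<subseteq> nset V 4" and TT: "finite \<T>"
  shows "(\<Sum>T\<in>\<T>. card {e \<in> M. T \<subseteq> e}) = (\<Sum>e\<in>M. card {T \<in> \<T>. T \<subseteq> e})"
  by (rule sum_multicount_gen[symmetric]) (use assms in auto)

lemma sum_card_superset_le:
  assumes V: "finite V" and M: "M \<subseteq> nset V 4" and TT: "\<T> \<subseteq> nset V 3"
  shows "(\<Sum>T\<in>\<T>. card {e \<in> M. T \<subseteq> e}) \<le> 4 * card M"
proof -
  have fin: "finite M" "finite \<T>" using assms by (meson finite_subset nset_finite)+
  have "(\<Sum>T\<in>\<T>. card {e \<in> M. T \<subseteq> e}) = (\<Sum>e\<in>M. card {T \<in> \<T>. T \<subseteq> e})"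
    using fin M by (intro sum_card_superset) auto
  also have "\<dots> \<le> (\<Sum>e\<in>M. 4)"
  proof (rule sum_mono)
    fix e assume "e \<in> M"
    then have e: "card e = 4" "finite e" using M V by (auto simp: nset_def finite_subset)
    have "card {T \<in> \<T>. T \<subseteq> e} \<le> card (nset e 3)"
      using e TT by (intro card_mono) (auto simp: nset_def)
    also have "\<dots> = 4" using e by (simp add: card_nset eval_nat_numeral)
    finally show "card {T \<in> \<T>. T \<subseteq> e} \<le> 4" .
  qed
  finally show ?thesis by simp
qed

text \<open>Pairs of a triple inside an edge are counted in two ways; every edge contains exactly
  four triples.\<close>

lemma sum_codegree:
  assumes V: "finite V" and E: "E \<subseteq> nset V 4"
  shows "(\<Sum>T\<in>nset V 3. card (nbr E T)) = 4 * card E"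
proof -
  have fin: "finite E" using assms by (meson finite_subset nset_finite)
  have "(\<Sum>T\<in>nset V 3. card (nbr E T)) = (\<Sum>T\<in>nset V 3. card {e \<in> E. T \<subseteq> e})"
    using E by (intro sum.cong) (auto simp: card_nbr nset_def)
  also have "\<dots> = (\<Sum>e\<in>E. card {T \<in> nset V 3. T \<subseteq> e})"
    using fin E V by (intro sum_card_superset) auto
  also have "\<dots> = (\<Sum>e\<in>E. 4)"
  proof (rule sum.cong)
    fix e assume "e \<in> E"
    then have e: "card e = 4" "finite e" "e \<subseteq> V" using E V by (auto simp: nset_def finite_subset)
    have "{T \<in> nset V 3. T \<subseteq> e} = nset e 3" using e by (auto simp: nset_def)
    then show "card {T \<in> nset V 3. T \<subseteq> e} = 4" using e by (simp add: card_nset eval_nat_numeral)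
  qed auto
  finally show ?thesis by simp
qed

section \<open>Copies of \<open>F\<^sub>7\<close> and heavy neighbourhoods\<close>

text \<open>\<open>T\<close>, \<open>D\<close> and \<open>w\<close> are the images of \<open>{1, 2, 3}\<close>, \<open>{4, 5, 6}\<close> and \<open>7\<close>.\<close>

definition F7_on :: "'a set set \<Rightarrow> 'a set \<Rightarrow> bool" where
  "F7_on E X \<longleftrightarrow> (\<exists>T D w. card T = 3 \<and> card D = 3 \<and> D \<subseteq> nbr E T \<and> w \<notin> T \<and> w \<notin> D \<and>
     insert w D \<in> E \<and> X = insert w (T \<union> D))"

lemma F7_on_card: "F7_on E X \<Longrightarrow> card X = 7"
proof -
  assume "F7_on E X"
  then obtain T D w where *: "card T = 3" "card D = 3" "D \<subseteq> nbr E T" "w \<notin> T" "w \<notin> D"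
    "X = insert w (T \<union> D)"
    unfolding F7_on_def by blast
  then have "finite T" "finite D" "T \<inter> D = {}"
    by (auto simp: nbr_def intro: card_ge_0_finite)
  then show ?thesis using * by (simp add: card_Un_disjoint)
qed

lemma F7_onI:
  "card T = 3 \<Longrightarrow> card D = 3 \<Longrightarrow> D \<subseteq> nbr E T \<Longrightarrow> w \<notin> T \<Longrightarrow> w \<notin> D \<Longrightarrow>
     insert w D \<in> E \<Longrightarrow> F7_on E (insert w (T \<union> D))"
  unfolding F7_on_def by blast

lemma nbr_mono: "E \<subseteq> E' \<Longrightarrow> nbr E T \<subseteq> nbr E' T"
  by (auto simp: nbr_def)

lemma F7_on_mono:
  assumes "F7_on E X" "E \<subseteq> E'"
  shows "F7_on E' X"
proof -
  obtain T D w where *: "card T = 3" "card D = 3" "D \<subseteq> nbr E T" "w \<notin> T" "w \<notin> D"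
    "insert w D \<in> E" "X = insert w (T \<union> D)"
    using assms(1) unfolding F7_on_def by blast
  then show ?thesis using nbr_mono[OF assms(2), of T] assms(2) F7_onI[of T D E' w] by blast
qed

lemma F7_on_subset: "F7_on E X \<Longrightarrow> E \<subseteq> nset V 4 \<Longrightarrow> X \<subseteq> V"
proof -
  assume X: "F7_on E X" and E: "E \<subseteq> nset V 4"
  obtain T D w where *: "card T = 3" "card D = 3" "D \<subseteq> nbr E T" 
    "insert w D \<in> E" "X = insert w (T \<union> D)"
    using X unfolding F7_on_def by blast
  then obtain x where "x \<in> D" by fastforce
  then have "insert x T \<in> E" using * by (auto simp: nbr_def)
  then show ?thesis using * E by (auto simp: nset_def subset_iff)
qed

text \<open>If an edge consists of three vertices \<open>D\<close> of \<open>nbr E T\<close> and a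
  vertex \<open>w\<close> outside \<open>T\<close>, then \<open>T\<close>, \<open>D\<close>,
  \<open>w\<close> form a copy. Hence each counted edge meets the three-element set
  \<open>T\<close>.\<close>

lemma card_heavy_le:
  assumes V: "finite V" and E: "E \<subseteq> nset V 4" and free: "\<And>X. \<not> F7_on E X"
    and T: "card T = 3" and B: "B \<subseteq> nbr E T"
  shows "card {e \<in> E. 3 \<le> card (e \<inter> B)} \<le> 3 * card V ^ 3"
proof -
  have finT: "finite T" using T card_ge_0_finite by force
  have "{e \<in> E. 3 \<le> card (e \<inter> B)} \<subseteq> {e \<in> nset V 4. e \<inter> T \<noteq> {}}"
  proof clarsimp
    fix e assume e: "e \<in> E" "3 \<le> card (e \<inter> B)"
    then have e4: "e \<in> nset V 4" using E by auto
    then have "finite e" using V by (auto simp: nset_def finite_subset)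
    obtain D where D: "D \<subseteq> e \<inter> B" "card D = 3" using e by (meson obtain_subset_with_card_n)
    then have finD: "finite D" using card_ge_0_finite by force
    have "card (e - D) = 1" using e4 D finD by (subst card_Diff_subset) (auto simp: nset_def)
    then obtain w where w: "e - D = {w}" using card_1_singletonE by blast
    have "w \<in> T"
    proof (rule ccontr)
      assume "w \<notin> T"
      moreover have "insert w D = e" "w \<notin> D" using w D by auto
      moreover have "D \<subseteq> nbr E T" using B D by auto
      ultimately have "F7_on E (insert w (T \<union> D))" using T D e by (intro F7_onI) auto
      then show False using free by blast
    qed
    then show "e \<in> nset V 4 \<and> e \<inter> T \<noteq> {}" using w e4 by blast
  qed
  then have "card {e \<in> E. 3 \<le> card (e \<inter> B)} \<le> card {e \<in> nset V 4. e \<inter> T \<noteq> {}}"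
    using V by (intro card_mono) auto
  also have "\<dots> \<le> card T * card V ^ (4 - 1)"
    by (rule card_nset_meet_le[OF V finT])
  finally show ?thesis using T by simp
qed

section \<open>Binomial estimates and the codegree count\<close>

lemma choose2: "real (n choose 2) = real n * (real n - 1) / 2"
  by (simp add: binomial_gbinomial gbinomial_prod_rev eval_nat_numeral fact_numeral field_simps)

lemma choose2_le: "real (n choose 2) \<le> real n ^ 2 / 2"
  unfolding choose2 by (simp add: field_simps power2_eq_square)

lemma choose3: "real (n choose 3) = real n * (real n - 1) * (real n - 2) / 6"
  by (simp add: binomial_gbinomial gbinomial_prod_rev eval_nat_numeral fact_numeral field_simps)

lemma choose3_le: "real (n choose 3) \<le> real n ^ 3 / 6"
proof (cases "n = 0")
  case False
  then have "3 * real n * real n \<ge> 2 * real n" by simp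
  then show ?thesis unfolding choose3 by (simp add: field_simps eval_nat_numeral)
qed (simp add: choose3)

lemma choose3_ge: "real (n choose 3) \<ge> real n ^ 3 / 6 - real n ^ 2 / 2"
  unfolding choose3 by (simp add: field_simps eval_nat_numeral)

text \<open>Triples are sorted by the number of their vertices in \<open>A\<close>. Three vertices:
  codegree 0. Two: all neighbours lie outside \<open>A\<close>, so at most \<open>b\<close>. One: at
  most \<open>a\<close>. None: at most \<open>a\<close>, and 0 for triples inside \<open>B\<close>.
  This last saving is added on the left to avoid truncated subtraction.\<close>

lemma codegree_count_bound:
  assumes V: "finite V" and E: "E \<subseteq> nset V 4" and AB: "A \<subseteq> V" "B \<subseteq> V - A"
    and A3: "\<And>e. e \<in> E \<Longrightarrow> card (e \<inter> A) < 3" and B3: "\<And>e. e \<in> E \<Longrightarrow> card (e \<inter> B) < 3"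
    and maxA: "\<And>T. T \<in> nset V 3 \<Longrightarrow> card (nbr E T) \<le> card A"
    and maxB: "\<And>T. T \<in> nset V 3 \<Longrightarrow> card (T \<inter> A) = 2 \<Longrightarrow> card (nbr E T - A) \<le> card B"
  defines "a \<equiv> card A" and "b \<equiv> card B" and "g \<equiv> card (V - A)"
  shows "4 * card E + a * (b choose 3) \<le> (a choose 2) * g * b + a * (g choose 2) * a + (g choose 3) * a"
proof -
  note fin = nset_finite[OF V, of 3]
  have finA: "finite A" "finite B" using V AB finite_subset by blast+
  define S where "S i = {T \<in> nset V 3. card (T \<inter> A) = i}" for i
  have finE: "finite E" using V E by (meson finite_subset nset_finite)
  have big: "card (e \<inter> C) \<ge> 3" if "T \<subseteq> C" "T \<subseteq> e" "T \<in> nset V 3" "e \<in> E" for e T C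
  proof -
    have "finite e" using that E V by (auto simp: nset_def finite_subset)
    then have "card T \<le> card (e \<inter> C)" using that by (intro card_mono) auto
    then show ?thesis using that by (simp add: nset_def)
  qed
  have nbrA: "nbr E T \<inter> A = {}" if "T \<in> S 2" for T
  proof (rule ccontr)
    assume "nbr E T \<inter> A \<noteq> {}"
    then obtain x where x: "x \<in> A" "insert x T \<in> E" "x \<notin> T" by (auto simp: nbr_def)
    have "finite T" using that V by (auto simp: S_def nset_def finite_subset)
    then have "card (insert x T \<inter> A) = 3" using x that by (simp add: S_def)
    then show False using A3[OF x(2)] by simp
  qed
  have zero: "nbr E T = {}" if "T \<in> nset V 3" "T \<subseteq> A \<or> T \<subseteq> B" for T
  proof (rule ccontr)
    assume "nbr E T \<noteq> {}"
    then obtain x where x: "insert x T \<in> E" by (auto simp: nbr_def)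
    have "card (insert x T \<inter> A) \<ge> 3 \<or> card (insert x T \<inter> B) \<ge> 3"
      using that big[OF _ subset_insertI that(1) x] by blast
    then show False using A3[OF x] B3[OF x] by auto
  qed
  have Bsub: "nset B 3 \<subseteq> S 0"
  proof
    fix T assume "T \<in> nset B 3"
    moreover from this have "T \<inter> A = {}" using AB by (auto simp: nset_def)
    ultimately show "T \<in> S 0" using AB by (auto simp: nset_def S_def)
  qed
  have S0: "S 0 = nset (V - A) 3"
    using finA by (auto simp: S_def nset_def)
  have dec: "nset V 3 = S 0 \<union> S 1 \<union> S 2 \<union> S 3"
  proof
    show "nset V 3 \<subseteq> S 0 \<union> S 1 \<union> S 2 \<union> S 3"
    proof
      fix T assume T: "T \<in> nset V 3"
      then have "card (T \<inter> A) \<le> card T" using V by (intro card_mono) (auto simp: nset_def finite_subset)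
      then have "card (T \<inter> A) \<in> {0,1,2,3}" using T by (auto simp: nset_def)
      then show "T \<in> S 0 \<union> S 1 \<union> S 2 \<union> S 3" using T by (auto simp: S_def)
    qed
  qed (auto simp: S_def)
  have finS: "finite (S i)" for i using fin by (auto simp: S_def)
  have disj: "S i \<inter> S j = {}" if "i \<noteq> j" for i j using that by (auto simp: S_def)
  have "4 * card E = (\<Sum>T\<in>nset V 3. card (nbr E T))"
    by (rule sum_codegree[OF V E, symmetric])
  also have "\<dots> = (\<Sum>T\<in>S 0. card (nbr E T)) + (\<Sum>T\<in>S 1. card (nbr E T)) + (\<Sum>T\<in>S 2. card (nbr E T))
     + (\<Sum>T\<in>S 3. card (nbr E T))"
    unfolding dec by (simp add: sum.union_disjoint finS disj Int_Un_distrib2)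
  finally have total: "4 * card E = \<dots>" .
  have "(\<Sum>T\<in>S 3. card (nbr E T)) = 0"
  proof (intro sum.neutral ballI)
    fix T assume T: "T \<in> S 3"
    then have "finite T" using V by (auto simp: S_def nset_def finite_subset)
    then have "T \<inter> A = T" using T by (intro card_subset_eq) (auto simp: S_def nset_def)
    then have "T \<subseteq> A" by blast
    then show "card (nbr E T) = 0" using zero[of T] T by (auto simp: S_def)
  qed
  moreover have "(\<Sum>T\<in>S 2. card (nbr E T)) \<le> (a choose 2) * g * b"
  proof -
    have "(\<Sum>T\<in>S 2. card (nbr E T)) \<le> (\<Sum>T\<in>S 2. b)"
    proof (rule sum_mono)
      fix T assume T: "T \<in> S 2"
      then show "card (nbr E T) \<le> b" using nbrA[OF T] maxB[of T]
        by (auto simp: S_def b_def Diff_triv)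
    qed
    also have "\<dots> = (a choose 2) * g * b"
      using card_nset_split[OF V AB(1), of 2 3] by (simp add: S_def a_def g_def)
    finally show ?thesis .
  qed
  moreover have "(\<Sum>T\<in>S 1. card (nbr E T)) \<le> a * (g choose 2) * a"
  proof -
    have "(\<Sum>T\<in>S 1. card (nbr E T)) \<le> (\<Sum>T\<in>S 1. a)"
      by (rule sum_mono) (auto simp: S_def a_def maxA)
    also have "\<dots> = a * (g choose 2) * a"
      using card_nset_split[OF V AB(1), of 1 3] by (simp add: S_def a_def g_def)
    finally show ?thesis .
  qed
  moreover have "(\<Sum>T\<in>S 0. card (nbr E T)) + a * (b choose 3) \<le> (g choose 3) * a"
  proof -
    have "(\<Sum>T\<in>S 0. card (nbr E T)) = (\<Sum>T\<in>S 0 - nset B 3. card (nbr E T)) + (\<Sum>T\<in>nset B 3. card (nbr E T))"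
      by (rule sum.subset_diff[OF Bsub finS])
    also have "(\<Sum>T\<in>nset B 3. card (nbr E T)) = 0"
    proof (intro sum.neutral ballI)
      fix T assume "T \<in> nset B 3"
      then have "T \<in> nset V 3" "T \<subseteq> B" using AB by (auto simp: nset_def)
      then show "card (nbr E T) = 0" using zero by simp
    qed
    also have "(\<Sum>T\<in>S 0 - nset B 3. card (nbr E T)) \<le> (\<Sum>T\<in>S 0 - nset B 3. a)"
      by (rule sum_mono) (auto simp: S_def a_def maxA)
    also have "\<dots> = (card (S 0) - card (nset B 3)) * a"
      using finA Bsub by (simp add: card_Diff_subset)
    also have "\<dots> = ((g choose 3) - (b choose 3)) * a"
      using V finA by (simp add: S0 card_nset g_def b_def)
    finally have *: "(\<Sum>T\<in>S 0. card (nbr E T)) \<le> ((g choose 3) - (b choose 3)) * a" by simp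
    have "b choose 3 \<le> g choose 3"
      using card_mono[OF finS Bsub] V finA by (simp add: S0 card_nset g_def b_def)
    then have "((g choose 3) - (b choose 3)) * a + a * (b choose 3) = (g choose 3) * a"
      by (metis add_mult_distrib le_add_diff_inverse2 mult.commute)
    then show ?thesis using * by linarith
  qed
  ultimately show ?thesis using total by linarith
qed

section \<open>Stability of \<open>F\<^sub>7\<close>-free 4-graphs\<close>

text \<open>The bound is \<open>3/8 = 24/64\<close> for \<open>\<epsilon> = 0\<close>, attained at \<open>a = b = g = 1/2\<close>.\<close>

lemma codegree_polynomial_bound_normalized:
  fixes a b g \<epsilon> :: real
  assumes nn: "0 \<le> a" "0 \<le> b" "0 \<le> g" and ba: "b \<le> a" and bg: "b \<le> g"
    and ag: "a + g = 1" and eps: "0 < \<epsilon>" "\<epsilon> \<le> 1" and ab: "a + b \<le> 1 - \<epsilon>"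
  shows "3 * a^2 * g * b + 3 * a^2 * g^2 + a * g^3 - a * b^3 \<le> 3 / 8 - \<epsilon>^2 / 32"
proof (cases "g \<le> a")
  case True
  define q where "q = a * g"
  have q0: "0 \<le> q" using nn by (simp add: q_def)
  have "(a - g)^2 \<ge> 0" by simp
  moreover have "(a + g)^2 = 1" using ag by simp
  ultimately have q1: "q \<le> 1 / 4" unfolding q_def by (simp add: power2_eq_square algebra_simps)
  have "g * g \<le> a * g" using True nn by (intro mult_right_mono)
  moreover have "b * b \<le> g * b" using bg nn by (intro mult_right_mono)
  ultimately have "(3*a*g - g^2 - g*b - b^2) \<ge> (g - b) * (2 * g)"
    using nn bg by (simp add: power2_eq_square algebra_simps)
  then have "a * (g - b) * (3*a*g - g^2 - g*b - b^2) \<ge> a * (g - b) * ((g - b) * (2 * g))"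
    using nn bg by (intro mult_left_mono) auto
  also have "a * (g - b) * ((g - b) * (2 * g)) = 2 * q * (g - b)^2"
    unfolding q_def by (simp add: power2_eq_square algebra_simps)
  finally have 1: "a * (g - b) * (3*a*g - g^2 - g*b - b^2) \<ge> 2 * q * (g - b)^2" .
  have "g - b \<ge> \<epsilon>" using ag ab by simp
  then have "(g - b)^2 \<ge> \<epsilon>^2" using eps by (intro power_mono) auto
  then have 2: "2 * q * (g - b)^2 \<ge> 2 * q * \<epsilon>^2" using q0 by (intro mult_left_mono) auto
  \<comment> \<open>The term \<open>6 * q^2\<close> is the value at \<open>b = g\<close>, at most
    3/8 since \<open>q\<close> is at most 1/4; the subtracted product is the loss caused by
    \<open>b < g\<close>.\<close>
  have 3: "3 * a^2 * g * b + 3 * a^2 * g^2 + a * g^3 - a * b^3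
      = 6 * q^2 - a * (g - b) * (3*a*g - g^2 - g*b - b^2)"
    unfolding q_def by (simp add: power2_eq_square power3_eq_cube algebra_simps)
  have "(1/4 - q) * (1/4 + q) \<ge> (1/4 - q) * (1/4)" using q0 q1 by (intro mult_left_mono) auto
  then have 4: "3/8 - 6 * q^2 \<ge> (3/2) * (1/4 - q)" by (simp add: power2_eq_square algebra_simps)
  \<comment> \<open>One of two losses is always available: \<open>1/4 - q\<close> is large when
    \<open>q\<close> is small, and \<open>2 * q * \<epsilon>^2\<close> is large otherwise. Scaling
    the first down by \<open>\<epsilon>^2\<close> lets the two be added.\<close>
  have "\<epsilon>^2 \<le> 1" using eps by (simp add: power_le_one)
  then have "(1/4 - q) * \<epsilon>^2 \<le> (1/4 - q)" using q1 by (simp add: mult_left_le)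
  then have "(3/2) * (1/4 - q) + 2 * q * \<epsilon>^2 \<ge> (3/2) * ((1/4 - q) * \<epsilon>^2) + 2 * (q * \<epsilon>^2)"
    unfolding mult.assoc[of 2 q] by (intro add_right_mono mult_left_mono) auto
  moreover have "(3/2) * ((1/4 - q) * \<epsilon>^2) + 2 * (q * \<epsilon>^2) = 3/8 * \<epsilon>^2 + (q * \<epsilon>^2) / 2"
    by (simp add: algebra_simps)
  moreover have "q * \<epsilon>^2 \<ge> 0" using q0 by simp
  moreover have "\<epsilon>^2 \<ge> 0" by simp
  ultimately have "(3/2) * (1/4 - q) + 2 * q * \<epsilon>^2 \<ge> \<epsilon>^2 / 32" by linarith
  then show ?thesis using 1 2 3 4 by linarith
next
  case False
  then have ag': "a \<le> g" by simp
  have "a * a \<le> a * g" using ag' nn by (intro mult_left_mono)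
  moreover have "b * b \<le> a * b" using ba nn by (intro mult_right_mono)
  ultimately have "(3*a*g - a^2 - a*b - b^2) \<ge> (a - b) * (2 * a)"
    using nn ba by (simp add: power2_eq_square algebra_simps)
  then have "a * (a - b) * (3*a*g - a^2 - a*b - b^2) \<ge> a * (a - b) * ((a - b) * (2 * a))"
    using nn ba by (intro mult_left_mono) auto
  also have "a * (a - b) * ((a - b) * (2 * a)) = 2 * (a * (a - b))^2"
    by (simp add: power2_eq_square algebra_simps)
  finally have 1: "a * (a - b) * (3*a*g - a^2 - a*b - b^2) \<ge> 2 * (a * (a - b))^2" .
  have g: "g = 1 - a" using ag by simp
  \<comment> \<open>At \<open>b = a\<close> the polynomial becomes \<open>a - 2 * a^4\<close>, with
    maximum 3/8 at \<open>a = 1/2\<close>; the subtracted product is the loss caused by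
    \<open>b < a\<close>.\<close>
  have 2: "3 * a^2 * g * b + 3 * a^2 * g^2 + a * g^3 - a * b^3
      = a - 2 * a^4 - a * (a - b) * (3*a*g - a^2 - a*b - b^2)"
    unfolding g by (simp add: eval_nat_numeral algebra_simps)
  have "(a - 1/2)^2 * (2 * a^2 + 2 * a + 3/2) \<ge> (a - 1/2)^2 * (3/2)"
    using nn by (intro mult_left_mono) auto
  moreover have "(a - 1/2)^2 * (2 * a^2 + 2 * a + 3/2) = 3/8 - a + 2 * a^4"
    by (simp add: eval_nat_numeral algebra_simps)
  ultimately have 3: "3/8 - a + 2 * a^4 \<ge> (3/2) * (a - 1/2)^2" by simp
  show ?thesis
  \<comment> \<open>As \<open>a + b \<le> 1 - \<epsilon>\<close>, either \<open>a\<close> lies below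
    1/2 by at least \<open>\<epsilon> / 4\<close>, or \<open>a - b\<close> is at least
    \<open>\<epsilon> / 2\<close>.\<close>
  proof (cases "1 - 2 * a \<ge> \<epsilon> / 2")
    case True
    then have "1/2 - a \<ge> \<epsilon> / 4" by simp
    then have "(1/2 - a)^2 \<ge> (\<epsilon> / 4)^2" using eps by (intro power_mono) auto
    then have "(a - 1/2)^2 \<ge> \<epsilon>^2 / 16" by (simp add: power2_eq_square algebra_simps)
    moreover have "(a * (a - b))^2 \<ge> 0" by simp
    moreover have "\<epsilon>^2 \<ge> 0" by simp
    ultimately show ?thesis using 1 2 3 by linarith
  next
    case False
    then have "a - b \<ge> \<epsilon> / 2" "a \<ge> 1/4" using ab eps by linarith+
    then have "a * (a - b) \<ge> (1/4) * (\<epsilon> / 2)" using eps by (intro mult_mono) auto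
    then have "(a * (a - b))^2 \<ge> ((1/4) * (\<epsilon> / 2))^2" using eps by (intro power_mono) auto
    then have "(a * (a - b))^2 \<ge> \<epsilon>^2 / 64" by (simp add: power2_eq_square algebra_simps)
    moreover have "(a - 1/2)^2 \<ge> 0" by simp
    ultimately show ?thesis using 1 2 3 by linarith
  qed
qed

text \<open>The polynomial is homogeneous of degree four, so division by \<open>n\<close> reduces to
  the normalized case.\<close>

lemma codegree_polynomial_bound:
  fixes a b g n \<epsilon> :: real
  assumes nn: "0 \<le> a" "0 \<le> b" "0 \<le> g" and ba: "b \<le> a" and bg: "b \<le> g"
    and ag: "a + g = n" and n: "0 < n" and eps: "0 < \<epsilon>" "\<epsilon> \<le> 1" and ab: "a + b \<le> (1 - \<epsilon>) * n"
  shows "3 * a^2 * g * b + 3 * a^2 * g^2 + a * g^3 - a * b^3 \<le> (3 / 8 - \<epsilon>^2 / 32) * n^4"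
proof -
  have "3 * (a/n)^2 * (g/n) * (b/n) + 3 * (a/n)^2 * (g/n)^2 + (a/n) * (g/n)^3 - (a/n) * (b/n)^3
      \<le> 3 / 8 - \<epsilon>^2 / 32"
  proof (rule codegree_polynomial_bound_normalized)
    show "a / n + g / n = 1" using ag n by (simp add: add_divide_distrib[symmetric])
    show "a / n + b / n \<le> 1 - \<epsilon>" using ab n by (simp add: add_divide_distrib[symmetric] divide_le_eq)
  qed (use nn ba bg n eps in \<open>auto simp: divide_right_mono\<close>)
  moreover have "3 * (a/n)^2 * (g/n) * (b/n) + 3 * (a/n)^2 * (g/n)^2 + (a/n) * (g/n)^3 - (a/n) * (b/n)^3
     = (3 * a^2 * g * b + 3 * a^2 * g^2 + a * g^3 - a * b^3) / n^4"
    using n by (simp add: eval_nat_numeral field_simps)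
  ultimately show ?thesis using n by (simp add: divide_le_eq)
qed

text \<open>If \<open>A\<close> and \<open>B\<close> left more than \<open>\<epsilon> * n\<close>
  vertices uncovered, the codegree count would contradict \<open>large\<close>. An edge inside
  \<open>A \<union> B\<close> that is not 2-2 has three vertices in \<open>A\<close> or in
  \<open>B\<close>, and \<open>card_heavy_le\<close> makes such edges rare.\<close>

lemma F7_free_stability:
  assumes V: "finite V" and E: "E \<subseteq> nset V 4" and free: "\<And>X. \<not> F7_on E X"
    and eps: "0 < \<epsilon>" "\<epsilon> \<le> 1"
    and large: "24 * real (card E) > (3 / 8 - \<epsilon>^2 / 32) * real (card V)^4 + 147 * real (card V)^3"
  shows "\<exists>A \<subseteq> V. real (card {e \<in> E. card (e \<inter> A) = 2})
     \<ge> real (card E) - 6 * real (card V)^3 - \<epsilon> * real (card V)^4"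
proof -
  define n where "n = card V"
  have finE: "finite E" using V E by (meson finite_subset nset_finite)
  have "\<epsilon>^2 \<le> 1" using eps by (simp add: power_le_one)
  then have "(3 / 8 - \<epsilon>^2 / 32) * real (card V)^4 \<ge> 0" by (intro mult_nonneg_nonneg) auto
  moreover have "real (card V)^3 \<ge> 0" by simp
  ultimately have "real (card E) > 0" using large by linarith
  then obtain e0 where e0: "e0 \<in> E" by fastforce
  then have "e0 \<subseteq> V" "card e0 = 4" using E by (auto simp: nset_def)
  then have n4: "n \<ge> 4" using V card_mono n_def by metis
  have nbrV: "nbr E T \<subseteq> V" for T using E by (auto simp: nbr_def nset_def)
  have nbrn: "card (nbr E T) < Suc n" for T using nbrV[of T] V card_mono n_def by (metis le_imp_less_Suc)
  obtain T1 where "T1 \<subseteq> V" "card T1 = 3" using n4 n_def obtain_subset_with_card_n[of 3 V] by auto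
  then have "T1 \<in> nset V 3" by (simp add: nset_def)
  then obtain T0 where T0: "T0 \<in> nset V 3" "\<And>T. T \<in> nset V 3 \<Longrightarrow> card (nbr E T) \<le> card (nbr E T0)"
    using ex_has_greatest_nat[of "\<lambda>T. T \<in> nset V 3" T1 "\<lambda>T. card (nbr E T)" "Suc n"] nbrn by blast
  define A where "A = nbr E T0"
  have A: "A \<subseteq> V" using nbrV by (simp add: A_def)
  have finA: "finite A" using A V finite_subset by blast
  have "\<exists>B T'. T' \<in> nset V 3 \<and> B \<subseteq> nbr E T' - A \<and>
     (\<forall>T \<in> nset V 3. card (T \<inter> A) = 2 \<longrightarrow> card (nbr E T - A) \<le> card B)"
  \<comment> \<open>If no triple has exactly two vertices in \<open>A\<close>, the maximality
    demanded of \<open>B\<close> is vacuous.\<close>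
  proof (cases "\<exists>T2. T2 \<in> nset V 3 \<and> card (T2 \<inter> A) = 2")
    case True
    have bd: "card (nbr E T - A) < Suc n" for T
      using nbrn[of T] card_mono[of "nbr E T" "nbr E T - A"] nbrV[of T] V finite_subset
      by (metis Diff_subset le_less_trans)
    from True obtain T2 where "T2 \<in> nset V 3 \<and> card (T2 \<inter> A) = 2" by blast
    then obtain T' where "T' \<in> nset V 3" "\<And>T. T \<in> nset V 3 \<and> card (T \<inter> A) = 2 \<Longrightarrow> card (nbr E T - A) \<le> card (nbr E T' - A)"
      using ex_has_greatest_nat[of "\<lambda>T. T \<in> nset V 3 \<and> card (T \<inter> A) = 2" T2 "\<lambda>T. card (nbr E T - A)" "Suc n"] bd by blast
    then show ?thesis by blast
  next
    case False
    then show ?thesis using T0(1) by blast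
  qed
  then obtain B T' where T': "T' \<in> nset V 3" and B: "B \<subseteq> nbr E T' - A"
    and maxB: "\<And>T. T \<in> nset V 3 \<Longrightarrow> card (T \<inter> A) = 2 \<Longrightarrow> card (nbr E T - A) \<le> card B"
    by blast
  have BV: "B \<subseteq> V - A" using B nbrV by blast
  have finB: "finite B" using BV V finite_subset by blast
  define E1 where "E1 = {e \<in> E. 3 \<le> card (e \<inter> A)}"
  define E2 where "E2 = {e \<in> E. 3 \<le> card (e \<inter> B)}"
  \<comment> \<open>The codegree count requires every edge to have fewer than three vertices in each
    of \<open>A\<close> and \<open>B\<close>. Passing to \<open>E0\<close> only shrinks
    neighbourhoods, so the maximality bounds persist.\<close>
  define E0 where "E0 = E - (E1 \<union> E2)"
  have cE1: "card E1 \<le> 3 * n ^ 3" unfolding E1_def n_def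
    using T0(1) by (intro card_heavy_le[OF V E free, of T0]) (auto simp: A_def nset_def)
  have cE2: "card E2 \<le> 3 * n ^ 3" unfolding E2_def n_def
    using T' B by (intro card_heavy_le[OF V E free, of T']) (auto simp: nset_def)
  have "E = E0 \<union> (E1 \<union> E2)" by (auto simp: E0_def E1_def E2_def)
  then have "card E \<le> card E0 + card (E1 \<union> E2)" by (metis card_Un_le)
  then have cE: "card E \<le> card E0 + 6 * n ^ 3" using card_Un_le[of E1 E2] cE1 cE2 by linarith
  define a b g where "a = card A" and "b = card B" and "g = card (V - A)"
  have E0E: "E0 \<subseteq> E" by (auto simp: E0_def)
  have finnbr: "finite (nbr E T)" for T using nbrV V finite_subset by blast
  have "B \<subseteq> nbr E T'" using B by blast
  then have ba: "b \<le> a"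
    using T0(2)[OF T'] card_mono[OF finnbr[of T'], of B] by (auto simp: a_def b_def A_def)
  have bg: "b \<le> g" using BV V by (auto simp: b_def g_def card_mono)
  have ag: "a + g = n" using A V finA card_mono[OF V A] by (simp add: a_def g_def n_def card_Diff_subset)
  have "4 * card E0 + card A * (card B choose 3) \<le> (card A choose 2) * card (V - A) * card B
     + card A * (card (V - A) choose 2) * card A + (card (V - A) choose 3) * card A"
  proof (rule codegree_count_bound[OF V _ A BV])
    fix T assume T: "T \<in> nset V 3"
    show "card (nbr E0 T) \<le> card A"
      using card_mono[OF finnbr nbr_mono[OF E0E, of T]] T0(2)[OF T] by (simp add: A_def)
    assume T2: "card (T \<inter> A) = 2"
    have "card (nbr E0 T - A) \<le> card (nbr E T - A)"
      using finnbr nbr_mono[OF E0E, of T] by (intro card_mono) auto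
    then show "card (nbr E0 T - A) \<le> card B" using maxB[OF T T2] by linarith
  qed (use E0E E in \<open>auto simp: E0_def E1_def E2_def\<close>)
  then have "real (4 * card E0 + a * (b choose 3)) \<le> real ((a choose 2) * g * b
     + a * (g choose 2) * a + (g choose 3) * a)"
    unfolding a_def b_def g_def by (rule of_nat_mono)
  then have main: "4 * real (card E0) + real a * real (b choose 3) \<le> real (a choose 2) * (real g * real b)
     + real (g choose 2) * (real a * real a) + real (g choose 3) * real a"
    by (simp add: mult_ac)
  have "real (a choose 2) * (real g * real b) \<le> (real a^2 / 2) * (real g * real b)"
    by (intro mult_right_mono choose2_le) auto
  moreover have "real (g choose 2) * (real a * real a) \<le> (real g^2 / 2) * (real a * real a)"
    by (intro mult_right_mono choose2_le) auto
  moreover have "real (g choose 3) * real a \<le> (real g^3 / 6) * real a"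
    by (intro mult_right_mono choose3_le) auto
  moreover have "real a * real (b choose 3) \<ge> real a * (real b^3 / 6 - real b^2 / 2)"
    by (intro mult_left_mono choose3_ge) auto
  moreover have "real a * real b^2 \<le> real n^3"
  proof -
    have "real a * real b^2 \<le> real n * real n^2"
      using ba ag by (intro mult_mono power_mono) auto
    then show ?thesis by (simp add: eval_nat_numeral)
  qed
  ultimately have "24 * real (card E0) \<le> 3 * real a^2 * real g * real b + 3 * real a^2 * real g^2
      + real a * real g^3 - real a * real b^3 + 3 * real n^3"
    using main by (simp add: power2_eq_square algebra_simps)
  moreover have "real (card E) \<le> real (card E0) + 6 * real n ^ 3"
    using cE by (metis (mono_tags, lifting) of_nat_add of_nat_le_iff of_nat_mult of_nat_numeral of_nat_power)
  \<comment> \<open>The constant 147 is 3 from the binomial estimate for \<open>b choose 3\<close>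
    plus 24 times 6 from the discarded edges.\<close>
  ultimately have up: "24 * real (card E) \<le> 3 * real a^2 * real g * real b + 3 * real a^2 * real g^2
      + real a * real g^3 - real a * real b^3 + 147 * real n^3" by linarith
  have ab: "real a + real b > (1 - \<epsilon>) * real n"
  proof (rule ccontr)
    assume "\<not> ?thesis"
    then have "3 * real a^2 * real g * real b + 3 * real a^2 * real g^2
      + real a * real g^3 - real a * real b^3 \<le> (3 / 8 - \<epsilon>^2 / 32) * real n^4"
      using ba bg ag n4 eps by (intro codegree_polynomial_bound) auto
    then show False using up large unfolding n_def by linarith
  qed
  \<comment> \<open>Edges meeting the small remainder \<open>R\<close> are simply given up.\<close>
  define R where "R = V - (A \<union> B)"
  have finR: "finite R" using V by (simp add: R_def)
  have "card (A \<union> B) = a + b" using finA finB BV by (auto simp: a_def b_def intro!: card_Un_disjoint)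
  moreover have "A \<union> B \<subseteq> V" "finite (A \<union> B)" using A BV finA finB by auto
  ultimately have cR: "card R + (a + b) = n"
    using card_Diff_subset[of "A \<union> B" V] card_mono[of V "A \<union> B"] V
    by (auto simp: R_def n_def)
  have "E \<subseteq> {e \<in> E. card (e \<inter> A) = 2} \<union> (E1 \<union> E2 \<union> {e \<in> nset V 4. e \<inter> R \<noteq> {}})"
  proof
    fix e assume e: "e \<in> E"
    then have e4: "e \<in> nset V 4" using E by auto
    show "e \<in> {e \<in> E. card (e \<inter> A) = 2} \<union> (E1 \<union> E2 \<union> {e \<in> nset V 4. e \<inter> R \<noteq> {}})"
    proof (cases "e \<inter> R = {}")
      case True
      then have "e - A = e \<inter> B" using e4 BV by (auto simp: R_def nset_def)
      moreover have "finite e" using e4 V by (auto simp: nset_def finite_subset)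
      ultimately have "card (e \<inter> A) + card (e \<inter> B) = 4"
        using card_split[of e A] e4 by (simp add: nset_def)
      then have "card (e \<inter> A) = 2 \<or> 3 \<le> card (e \<inter> A) \<or> 3 \<le> card (e \<inter> B)" by linarith
      then show ?thesis using e by (auto simp: E1_def E2_def)
    qed (use e4 in auto)
  qed
  then have "card E \<le> card ({e \<in> E. card (e \<inter> A) = 2} \<union> (E1 \<union> E2 \<union> {e \<in> nset V 4. e \<inter> R \<noteq> {}}))"
    using finE V by (intro card_mono) (auto simp: E1_def E2_def)
  also have "\<dots> \<le> card {e \<in> E. card (e \<inter> A) = 2} + (card E1 + card E2 + card {e \<in> nset V 4. e \<inter> R \<noteq> {}})"
    by (meson add_le_mono card_Un_le le_refl order_trans)
  also have "card {e \<in> nset V 4. e \<inter> R \<noteq> {}} \<le> card R * n ^ 3"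
    using card_nset_meet_le[OF V finR, of 4] by (simp add: n_def)
  finally have "card E \<le> card {e \<in> E. card (e \<inter> A) = 2} + (6 * n ^ 3 + card R * n ^ 3)"
    using cE1 cE2 by linarith
  then have "real (card E) \<le> real (card {e \<in> E. card (e \<inter> A) = 2} + (6 * n ^ 3 + card R * n ^ 3))"
    by (rule of_nat_mono)
  also have "\<dots> = real (card {e \<in> E. card (e \<inter> A) = 2}) + 6 * real n ^ 3 + real (card R) * real n ^ 3"
    by simp
  also have "real (card R) * real n ^ 3 \<le> (\<epsilon> * real n) * real n ^ 3"
  proof (rule mult_right_mono)
    have "real (card R) + (real a + real b) = real n" using cR by (metis of_nat_add)
    then show "real (card R) \<le> \<epsilon> * real n" using ab by (simp add: algebra_simps)
  qed simp
  finally show ?thesis using A unfolding n_def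
    by (intro exI[of _ A]) (simp add: eval_nat_numeral algebra_simps)
qed

section \<open>Robust copies near a cut\<close>

text \<open>The index counts only the other three vertices, so it does not depend on the side of
  \<open>v\<close>. This allows the same quantities to describe the cut before and after
  \<open>v\<close> is moved.\<close>

definition link_deg :: "'a set set \<Rightarrow> 'a set \<Rightarrow> 'a \<Rightarrow> nat \<Rightarrow> nat" where
  "link_deg E A v i = card {e \<in> E. v \<in> e \<and> card ((e - {v}) \<inter> A) = i}"

text \<open>A rich vertex has many link triples inside one part, or many of both mixed types; either situation
  forces copies of \<open>F\<^sub>7\<close> through it.\<close>

definition rich :: "'a set \<Rightarrow> 'a set set \<Rightarrow> 'a set \<Rightarrow> 'a \<Rightarrow> bool" where
  "rich V E A v \<longleftrightarrow> (let d = \<lambda>i. real (link_deg E A v i); m = real (card V) ^ 3 / 10000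
     in d 3 > m \<or> d 0 > m \<or> (d 1 > m \<and> d 2 > m))"

definition missing :: "'a set \<Rightarrow> 'a set set \<Rightarrow> 'a set \<Rightarrow> 'a set set" where
  "missing V E A = {e \<in> nset V 4. card (e \<inter> A) = 2 \<and> e \<notin> E}"

text \<open>The copy need not contain \<open>S\<close>; it only has to avoid every small set that is
  disjoint from \<open>S\<close>. Disjoint seeds can therefore be turned into disjoint copies one
  after another.\<close>

definition seed :: "'a set set \<Rightarrow> nat \<Rightarrow> 'a set \<Rightarrow> bool" where
  "seed E q S \<longleftrightarrow> (\<forall>F. finite F \<and> card F \<le> q \<and> F \<inter> S = {} \<longrightarrow> (\<exists>X. F7_on E X \<and> X \<inter> F = {}))"

lemma card_compl_Int:
  assumes "finite e" "e \<subseteq> V"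
  shows "card (e \<inter> (V - A)) = card e - card (e \<inter> A)"
proof -
  have "e \<inter> (V - A) = e - A" using assms by auto
  then show ?thesis using card_split[OF assms(1), of A] by simp
qed

text \<open>For each \<open>x\<close> in \<open>X\<close>, at most \<open>n^2\<close> four-sets
  contain both \<open>v\<close> and \<open>x\<close>, so the sets through \<open>v\<close> that meet
  \<open>X\<close> cannot exhaust the family.\<close>

lemma ex_edge_avoiding:
  assumes V: "finite V" and E: "\<E> \<subseteq> nset V 4" "\<And>e. e \<in> \<E> \<Longrightarrow> v \<in> e"
    and X: "finite X" "v \<notin> X" and "real (card \<E>) > real (card X) * real (card V)^2"
  shows "\<exists>e\<in>\<E>. e \<inter> X = {}"
proof (rule ccontr)
  assume "\<not> ?thesis"
  then have "\<E> \<subseteq> {e \<in> nset V 4. v \<in> e \<and> e \<inter> X \<noteq> {}}" using E by auto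
  then have "card \<E> \<le> card {e \<in> nset V 4. v \<in> e \<and> e \<inter> X \<noteq> {}}" using V by (intro card_mono) auto
  also have "\<dots> \<le> card X * card V ^ 2" using card_nset_star_meet_le[OF V X, of 4] by simp
  finally have "real (card \<E>) \<le> real (card X * card V ^ 2)" by (rule of_nat_mono)
  then show False using assms(6) by simp
qed

text \<open>Both parts are nearly half of \<open>V\<close> and almost all 2-2 sets are edges. The
  density 10^(-10) of missing sets is small enough for the averaging in
  \<open>ex_typical_triple\<close>.\<close>

locale near_cut =
  fixes V :: "'a set" and E :: "'a set set" and A :: "'a set" and n :: nat
  assumes finV: "finite V" and E: "E \<subseteq> nset V 4" and AV: "A \<subseteq> V" and n: "n = card V"
    and large: "real n \<ge> 1000000"
    and cA: "real (card A) \<ge> 45 / 100 * real n" and cB: "real (card (V - A)) \<ge> 45 / 100 * real n"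
    and few_missing: "real (card (missing V E A)) \<le> real n ^ 4 / 10000000000"
begin

lemma finE: "finite E" using finV E by (meson finite_subset nset_finite)

lemma edge: "e \<in> E \<Longrightarrow> finite e \<and> e \<subseteq> V \<and> card e = 4"
  using E finV by (auto simp: nset_def finite_subset)

lemma missing_swap: "missing V E (V - A) = missing V E A"
proof -
  have "card (e \<inter> (V - A)) = 2 \<longleftrightarrow> card (e \<inter> A) = 2" if "e \<in> nset V 4" for e
    using that card_compl_Int[of e V A] finV card_mono[of e "e \<inter> A"]
    by (auto simp: nset_def finite_subset)
  then show ?thesis by (auto simp: missing_def)
qed

text \<open>All assumptions are symmetric in the two parts, so each statement about \<open>A\<close>
  can be reused for its complement.\<close>

lemma swap: "near_cut V E (V - A) n"
proof
  have "V - (V - A) = A" using AV by auto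
  then show "45 / 100 * real n \<le> real (card (V - (V - A)))" using cA by simp
qed (use finV E n large cB few_missing missing_swap in auto)

text \<open>After removal of \<open>F\<close> each part keeps 44/100 of \<open>n\<close>, which
  leaves about 0.0387 n^3 triples of this shape. They matter because adding another vertex of
  \<open>A\<close> makes a 2-2 set.\<close>

lemma many_triples:
  assumes F: "finite F" "real (card F) \<le> real n / 100"
  shows "real (card {T \<in> nset (V - F) 3. card (T \<inter> A) = 1}) \<ge> 3 / 100 * real n ^ 3"
proof -
  have size: "real (card (C - F)) \<ge> 44 / 100 * real n" if "C \<subseteq> V" "real (card C) \<ge> 45 / 100 * real n" for C
  proof -
    have "card C \<le> card (C - F) + card F"
      using F card_Un_le[of "C - F" F] card_mono[of "(C - F) \<union> F" C] that finV finite_subset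
      by (metis Un_Diff_cancel2 Un_upper1 finite_UnI order_trans)
    then have "real (card C) \<le> real (card (C - F)) + real (card F)" by (metis of_nat_add of_nat_mono)
    then show ?thesis using that F by linarith
  qed
  define x y where "x = real (card (A - F))" and "y = real (card (V - F - A))"
  have x: "x \<ge> 44 / 100 * real n" using size[OF AV cA] by (simp add: x_def)
  have "V - F - A = V - A - F" by auto
  then have y: "y \<ge> 44 / 100 * real n" using size[OF _ cB] by (simp add: y_def)
  have eq: "{T \<in> nset (V - F) 3. card (T \<inter> A) = 1} = {T \<in> nset (V - F) 3. card (T \<inter> (A - F)) = 1}"
  proof -
    have "T \<inter> A = T \<inter> (A - F)" if "T \<in> nset (V - F) 3" for T using that by (auto simp: nset_def)
    then show ?thesis by auto
  qed
  have "V - F - (A - F) = V - F - A" by auto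
  then have "real (card {T \<in> nset (V - F) 3. card (T \<inter> A) = 1}) = x * (y * (y - 1) / 2)"
    unfolding eq using card_nset_split[of "V - F" "A - F" 1 3] finV AV Diff_mono[OF AV subset_refl, of F]
    by (simp add: choose2 x_def y_def)
  moreover have "x * (y * (y - 1) / 2) \<ge> (44 / 100 * real n) * ((44 / 100 * real n) * (40 / 100 * real n) / 2)"
    using x y large by (intro mult_mono divide_right_mono) auto
  moreover have "(44 / 100 * real n) * ((44 / 100 * real n) * (40 / 100 * real n) / 2) = 3872 / 100000 * real n ^ 3"
    by (simp add: power3_eq_cube)
  moreover have "real n ^ 3 \<ge> 0" by simp
  ultimately show ?thesis by linarith
qed

text \<open>A vertex of \<open>A\<close> outside \<open>T\<close> and \<open>nbr E T\<close>
  completes \<open>T\<close> to a missing set, and each missing set contains at most four triples.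
  If every triple failed, the product of 2/10^5 and 25/10^6, which is 5/10^10, would exceed the
  available 4/10^10.\<close>

lemma ex_typical_triple:
  assumes TT: "\<T> \<subseteq> {T \<in> nset V 3. card (T \<inter> A) = 1}" and many: "real (card \<T>) > 2 / 100000 * real n ^ 3"
  shows "\<exists>T\<in>\<T>. real (card (A - T - nbr E T)) \<le> 25 / 1000000 * real n"
proof (rule ccontr)
  assume "\<not> ?thesis"
  then have big: "real (card (A - T - nbr E T)) \<ge> 25 / 1000000 * real n" if "T \<in> \<T>" for T
    using that by force
  let ?M = "missing V E A"
  have "card (A - T - nbr E T) \<le> card {e \<in> ?M. T \<subseteq> e}" if "T \<in> \<T>" for T
  proof (rule card_inj_on_le[of "\<lambda>x. insert x T"])
    have T: "T \<subseteq> V" "card T = 3" "card (T \<inter> A) = 1" "finite T"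
      using that TT finV by (auto simp: nset_def finite_subset)
    show "inj_on (\<lambda>x. insert x T) (A - T - nbr E T)" by (rule inj_onI) auto
    show "(\<lambda>x. insert x T) ` (A - T - nbr E T) \<subseteq> {e \<in> ?M. T \<subseteq> e}"
      using T AV by (auto simp: missing_def nset_def nbr_def Int_insert_left)
    show "finite {e \<in> ?M. T \<subseteq> e}" using finV by (auto simp: missing_def)
  qed
  then have "(\<Sum>T\<in>\<T>. card (A - T - nbr E T)) \<le> (\<Sum>T\<in>\<T>. card {e \<in> ?M. T \<subseteq> e})"
    by (rule sum_mono)
  also have "\<dots> \<le> 4 * card ?M"
    using TT by (intro sum_card_superset_le[OF finV]) (auto simp: missing_def)
  finally have "real (\<Sum>T\<in>\<T>. card (A - T - nbr E T)) \<le> real (4 * card ?M)" by (rule of_nat_mono)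
  then have up: "(\<Sum>T\<in>\<T>. real (card (A - T - nbr E T))) \<le> 4 * (real n ^ 4 / 10000000000)"
    using few_missing by simp
  have "(\<Sum>T\<in>\<T>. real (card (A - T - nbr E T))) \<ge> (\<Sum>T\<in>\<T>. 25 / 1000000 * real n)"
    using big by (rule sum_mono)
  then have "real (card \<T>) * (25 / 1000000 * real n) \<le> 4 * (real n ^ 4 / 10000000000)"
    using up by (simp only: sum_constant of_nat_id)
  moreover have "real (card \<T>) * (25 / 1000000 * real n) > (2 / 100000 * real n ^ 3) * (25 / 1000000 * real n)"
    using many large by (intro mult_strict_right_mono) auto
  moreover have "(2 / 100000 * real n ^ 3) * (25 / 1000000 * real n) = 50 / 100000000000 * real n ^ 4"
    by (simp add: eval_nat_numeral)
  moreover have "real n ^ 4 \<ge> 0" by simp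
  ultimately show False by linarith
qed

lemma link_deg_swap:
  assumes "i \<le> 3"
  shows "link_deg E (V - A) v i = link_deg E A v (3 - i)"
proof -
  have "card ((e - {v}) \<inter> (V - A)) = i \<longleftrightarrow> card ((e - {v}) \<inter> A) = 3 - i" if "e \<in> E" "v \<in> e" for e
  proof -
    have "finite (e - {v})" "e - {v} \<subseteq> V" "card (e - {v}) = 3" using edge[OF that(1)] that by auto
    moreover from this have "card ((e - {v}) \<inter> A) \<le> 3" by (metis card_mono inf_le1)
    ultimately show ?thesis using card_compl_Int[of "e - {v}" V A] assms by auto
  qed
  then have "{e \<in> E. v \<in> e \<and> card ((e - {v}) \<inter> (V - A)) = i} = {e \<in> E. v \<in> e \<and> card ((e - {v}) \<inter> A) = 3 - i}"
    by auto
  then show ?thesis by (simp add: link_deg_def)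
qed

text \<open>The neighbourhood of a typical triple \<open>T\<close> covers almost all of
  \<open>A\<close>, hence also the three other vertices of some edge at \<open>v\<close> counted by
  the hypothesis. The vertex \<open>v\<close> plays the part of \<open>w\<close>.\<close>

lemma F7_on_of_monochromatic_link:
  assumes F: "finite F" "real (card F) \<le> 25 / 1000000 * real n" "v \<notin> F"
    and d: "real (link_deg E A v 3) > real n ^ 3 / 10000"
  shows "\<exists>X. F7_on E X \<and> X \<inter> F = {}"
proof -
  let ?F = "insert v F"
  have "real (card ?F) \<le> real n / 100" using F large by simp
  then have "real (card {T \<in> nset (V - ?F) 3. card (T \<inter> A) = 1}) \<ge> 3 / 100 * real n ^ 3"
    using F by (intro many_triples) auto
  moreover have "real n ^ 3 > 0" using large by simp
  ultimately have "real (card {T \<in> nset (V - ?F) 3. card (T \<inter> A) = 1}) > 2 / 100000 * real n ^ 3" by linarith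
  then obtain T where T: "T \<in> nset (V - ?F) 3" "real (card (A - T - nbr E T)) \<le> 25 / 1000000 * real n"
    using ex_typical_triple[of "{T \<in> nset (V - ?F) 3. card (T \<inter> A) = 1}"] nset_mono[of "V - ?F" V 3] by auto
  have finT: "finite T" "card T = 3" using T nset_mem_finite[of "V - ?F" T 3] finV by (auto simp: nset_def)
  \<comment> \<open>The vertex \<open>v\<close> is removed since the edge sought must contain it; as
    \<open>w\<close> it need not lie in \<open>nbr E T\<close>.\<close>
  define X where "X = (F \<union> T \<union> (A - T - nbr E T)) - {v}"
  have finA: "finite A" using AV finV finite_subset by blast
  have finX: "finite X" using F finT finA by (simp add: X_def)
  have "card X \<le> card (F \<union> T \<union> (A - T - nbr E T))"
    unfolding X_def using F finT finA by (intro card_mono) auto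
  also have "\<dots> \<le> card F + card T + card (A - T - nbr E T)"
    by (meson add_le_mono card_Un_le le_refl order_trans)
  finally have "real (card X) \<le> real (card F + card T + card (A - T - nbr E T))" by (rule of_nat_mono)
  then have "real (card X) \<le> real n / 10000" using F T finT large by simp
  then have "real (card X) * real n ^ 2 \<le> real n / 10000 * real n ^ 2" by (rule mult_right_mono) simp
  then have "real (card X) * real n ^ 2 < real (link_deg E A v 3)"
    using d by (simp add: power2_eq_square power3_eq_cube)
  then have "\<exists>e\<in>{e \<in> E. v \<in> e \<and> card ((e - {v}) \<inter> A) = 3}. e \<inter> X = {}"
    using finV E finX n by (intro ex_edge_avoiding[where v = v]) (auto simp: X_def link_deg_def)
  then obtain e where e: "e \<in> E" "v \<in> e" "card ((e - {v}) \<inter> A) = 3" "e \<inter> X = {}" by blast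
  define D where "D = e - {v}"
  have D: "card D = 3" "finite D" using edge[OF e(1)] e(2) by (auto simp: D_def)
  then have "D \<inter> A = D" using e(3) by (intro card_subset_eq) (auto simp: D_def)
  then have "D \<subseteq> nbr E T" using e(4) by (auto simp: D_def X_def)
  moreover have "insert v D = e" "v \<notin> D" using e(2) by (auto simp: D_def)
  moreover have "v \<notin> T" using T by (auto simp: nset_def)
  ultimately have "F7_on E (insert v (T \<union> D))" using finT D e by (intro F7_onI) auto
  moreover have "insert v (T \<union> D) \<inter> F = {}"
    using F(3) T(1) e(4) by (auto simp: D_def X_def nset_def)
  ultimately show ?thesis by blast
qed

text \<open>A link triple with one vertex in \<open>A\<close> serves as \<open>T\<close>, which puts
  \<open>v\<close> into \<open>nbr E T\<close>. An edge at \<open>v\<close> with two further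
  vertices in \<open>A\<close> then supplies \<open>D\<close>, made of \<open>v\<close> and these
  two, and its fourth vertex is \<open>w\<close>.\<close>

lemma F7_on_of_mixed_link:
  assumes F: "finite F" "real (card F) \<le> 25 / 1000000 * real n" "v \<notin> F"
    and d1: "real (link_deg E A v 1) > real n ^ 3 / 10000"
    and d2: "real (link_deg E A v 2) > real n ^ 3 / 10000"
  shows "\<exists>X. F7_on E X \<and> X \<inter> F = {}"
proof -
  define L1 where "L1 = {e \<in> E. v \<in> e \<and> card ((e - {v}) \<inter> A) = 1}"
  define L1F where "L1F = {e \<in> L1. e \<inter> F = {}}"
  have finL1: "finite L1" using finE by (simp add: L1_def)
  define \<T> where "\<T> = (\<lambda>e. e - {v}) ` L1F"
  have inj: "inj_on (\<lambda>e. e - {v}) L1F" by (rule inj_onI) (auto simp: L1F_def L1_def)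
  have "card (L1 - L1F) \<le> card {e \<in> nset V 4. v \<in> e \<and> e \<inter> F \<noteq> {}}"
    using finV E by (intro card_mono) (auto simp: L1F_def L1_def)
  also have "\<dots> \<le> card F * n ^ 2" using card_nset_star_meet_le[OF finV F(1,3), of 4] n by simp
  finally have "card L1 \<le> card L1F + card F * n ^ 2"
    using finL1 card_Un_le[of L1F "L1 - L1F"] by (auto simp: L1F_def Un_absorb1)
  then have "real (card L1) \<le> real (card L1F + card F * n ^ 2)" by (rule of_nat_mono)
  then have "real (card L1) \<le> real (card L1F) + real (card F) * real n ^ 2" by simp
  moreover have "real (card F) * real n ^ 2 \<le> 25 / 1000000 * real n * real n ^ 2"
    using F(2) by (rule mult_right_mono) simp
  moreover have "25 / 1000000 * real n * real n ^ 2 = 25 / 1000000 * real n ^ 3"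
    by (simp add: power2_eq_square power3_eq_cube)
  moreover have "real (card L1) > real n ^ 3 / 10000" using d1 by (simp add: link_deg_def L1_def)
  moreover have "real n ^ 3 > 0" using large by simp
  \<comment> \<open>At least 1/10^4 minus 25/10^6 of \<open>n^3\<close> link triples survive, more
    than the 2/10^5 needed for a typical one.\<close>
  ultimately have "real (card L1F) > 2 / 100000 * real n ^ 3" by linarith
  then have "real (card \<T>) > 2 / 100000 * real n ^ 3" using inj by (simp add: \<T>_def card_image)
  moreover have "\<T> \<subseteq> {T \<in> nset V 3. card (T \<inter> A) = 1}"
  proof
    fix T assume "T \<in> \<T>"
    then obtain e where "e \<in> E" "v \<in> e" "card ((e - {v}) \<inter> A) = 1" "T = e - {v}"
      by (auto simp: \<T>_def L1F_def L1_def)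
    with edge[of e] show "T \<in> {T \<in> nset V 3. card (T \<inter> A) = 1}" by (auto simp: nset_def)
  qed
  ultimately obtain T where T: "T \<in> \<T>" "real (card (A - T - nbr E T)) \<le> 25 / 1000000 * real n"
    using ex_typical_triple by blast
  obtain e1 where e1: "e1 \<in> E" "v \<in> e1" "T = e1 - {v}" "e1 \<inter> F = {}"
    using T(1) by (auto simp: \<T>_def L1F_def L1_def)
  have finT: "finite T" "card T = 3" using e1 edge[OF e1(1)] by auto
  have vT: "v \<in> nbr E T" using e1 by (auto simp: nbr_def insert_absorb)
  define X where "X = (F \<union> T \<union> (A - T - nbr E T)) - {v}"
  have finA: "finite A" using AV finV finite_subset by blast
  have finX: "finite X" using F finT finA by (simp add: X_def)
  have "card X \<le> card (F \<union> T \<union> (A - T - nbr E T))"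
    unfolding X_def using F finT finA by (intro card_mono) auto
  also have "\<dots> \<le> card F + card T + card (A - T - nbr E T)"
    by (meson add_le_mono card_Un_le le_refl order_trans)
  finally have "real (card X) \<le> real (card F + card T + card (A - T - nbr E T))" by (rule of_nat_mono)
  then have "real (card X) \<le> real n / 10000" using F T finT large by simp
  then have "real (card X) * real n ^ 2 \<le> real n / 10000 * real n ^ 2" by (rule mult_right_mono) simp
  then have "real (card X) * real n ^ 2 < real (link_deg E A v 2)"
    using d2 by (simp add: power2_eq_square power3_eq_cube)
  then have "\<exists>e\<in>{e \<in> E. v \<in> e \<and> card ((e - {v}) \<inter> A) = 2}. e \<inter> X = {}"
    using finV E finX n by (intro ex_edge_avoiding[where v = v]) (auto simp: X_def link_deg_def)
  then obtain e where e: "e \<in> E" "v \<in> e" "card ((e - {v}) \<inter> A) = 2" "e \<inter> X = {}" by blast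
  define P where "P = (e - {v}) \<inter> A"
  have P: "card P = 2" "finite P" "v \<notin> P" "P \<subseteq> e" using e edge[OF e(1)] by (auto simp: P_def)
  define D where "D = insert v P"
  have D: "card D = 3" "finite D" "D \<subseteq> e" using P e(2) by (auto simp: D_def)
  have "card (e - D) = 1" using D edge[OF e(1)] by (simp add: card_Diff_subset)
  then obtain w where w: "e - D = {w}" using card_1_singletonE by blast
  have "P \<subseteq> nbr E T" using e(4) by (auto simp: P_def X_def)
  then have "D \<subseteq> nbr E T" using vT by (simp add: D_def)
  moreover have "insert w D = e" "w \<notin> D" using w D(3) by auto
  moreover have "w \<notin> T" using w e(4) by (auto simp: D_def X_def)
  ultimately have "F7_on E (insert w (T \<union> D))" using finT D e by (intro F7_onI) auto
  moreover have "insert w (T \<union> D) \<inter> F = {}"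
  proof -
    have "e \<inter> F = {}" using e(4) F(3) by (auto simp: X_def)
    then show ?thesis using e1 D(3) w by blast
  qed
  ultimately show ?thesis by blast
qed

lemma rich_seed:
  assumes q: "real q \<le> 25 / 1000000 * real n" and r: "rich V E A v"
  shows "seed E q {v}"
  unfolding seed_def
proof (intro allI impI, elim conjE)
  fix F :: "'a set" assume F: "finite F" "card F \<le> q" "F \<inter> {v} = {}"
  have F': "real (card F) \<le> 25 / 1000000 * real n" "v \<notin> F" using F q by auto
  interpret sw: near_cut V E "V - A" n by (rule swap)
  consider "real (link_deg E A v 3) > real n ^ 3 / 10000" | "real (link_deg E A v 0) > real n ^ 3 / 10000"
    | "real (link_deg E A v 1) > real n ^ 3 / 10000" "real (link_deg E A v 2) > real n ^ 3 / 10000"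
    using r n by (auto simp: rich_def Let_def)
  then show "\<exists>X. F7_on E X \<and> X \<inter> F = {}"
  proof cases
    case 1 then show ?thesis using F7_on_of_monochromatic_link F F' by blast
  next
    case 2 
    then show ?thesis using sw.F7_on_of_monochromatic_link[of F v] F F' link_deg_swap[of 3 v] by simp
  next
    case 3 then show ?thesis using F7_on_of_mixed_link F F' by blast
  qed
qed

text \<open>Three vertices of \<open>e\<close> in \<open>A\<close> serve as \<open>D\<close>. A
  triple with one vertex in \<open>A\<close> that is not joined to all of \<open>D\<close> gives a
  missing set through a vertex of \<open>D\<close>; it lies in \<open>V - L\<close> because both the
  triple and \<open>e\<close> avoid \<open>L\<close>. The degree bound excludes at most 72/10^4 of
  \<open>n^3\<close> triples, fewer than the 3/100 available.\<close>

lemma heavy_edge_seed: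
  assumes e: "e \<in> E" "e \<subseteq> V - L" "3 \<le> card (e \<inter> A)" and L: "finite L"
    and size: "real (card L) + real q + 4 \<le> real n / 100"
    and deg: "\<And>x. x \<in> e \<Longrightarrow> real (card {m \<in> missing (V - L) E A. x \<in> m}) \<le> 24 / 10000 * real n ^ 3"
  shows "seed E q e"
  unfolding seed_def
proof (intro allI impI, elim conjE)
  fix F :: "'a set" assume F: "finite F" "card F \<le> q" "F \<inter> e = {}"
  have e4: "finite e" "card e = 4" using edge e by auto
  obtain D where D: "D \<subseteq> e \<inter> A" "card D = 3" using e by (meson obtain_subset_with_card_n)
  then have finD: "finite D" using card_ge_0_finite by force
  have "card (e - D) = 1" using e4 D finD by (subst card_Diff_subset) auto
  then obtain w where w: "e - D = {w}" using card_1_singletonE by blast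
  let ?F = "F \<union> L \<union> e"
  let ?M = "missing (V - L) E A"
  have "card ?F \<le> card F + card L + card e"
    by (meson add_le_mono card_Un_le le_refl order_trans)
  then have "card ?F \<le> card L + q + 4" using F e4 by linarith
  then have "real (card ?F) \<le> real (card L + q + 4)" by (rule of_nat_mono)
  then have "real (card ?F) \<le> real n / 100" using size by simp
  then have many: "real (card {T \<in> nset (V - ?F) 3. card (T \<inter> A) = 1}) \<ge> 3 / 100 * real n ^ 3"
    using F L e4 by (intro many_triples) auto
  have finM: "finite ?M" using finV by (auto simp: missing_def)
  have "\<exists>T \<in> {T \<in> nset (V - ?F) 3. card (T \<inter> A) = 1}. D \<subseteq> nbr E T"
  proof (rule ccontr)
    assume neg: "\<not> ?thesis"
    have "{T \<in> nset (V - ?F) 3. card (T \<inter> A) = 1} \<subseteq> (\<Union>x\<in>D. (\<lambda>m. m - {x}) ` {m \<in> ?M. x \<in> m})"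
    proof
      fix T assume T: "T \<in> {T \<in> nset (V - ?F) 3. card (T \<inter> A) = 1}"
      then obtain x where x: "x \<in> D" "x \<notin> nbr E T" using neg by auto
      have "finite T" using T finV by (auto simp: nset_def finite_subset)
      moreover have "x \<in> V - L" "x \<in> A" "x \<notin> T" using x D e T by (auto simp: nset_def)
      ultimately have "insert x T \<in> ?M" using T x by (auto simp: missing_def nset_def nbr_def)
      then have "T \<in> (\<lambda>m. m - {x}) ` {m \<in> ?M. x \<in> m}"
        using \<open>x \<notin> T\<close> by (intro image_eqI[of _ _ "insert x T"]) auto
      then show "T \<in> (\<Union>x\<in>D. (\<lambda>m. m - {x}) ` {m \<in> ?M. x \<in> m})" using x by blast
    qed
    then have "card {T \<in> nset (V - ?F) 3. card (T \<inter> A) = 1} \<le> card (\<Union>x\<in>D. (\<lambda>m. m - {x}) ` {m \<in> ?M. x \<in> m})"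
      using finD finM by (intro card_mono) auto
    also have "\<dots> \<le> (\<Sum>x\<in>D. card ((\<lambda>m. m - {x}) ` {m \<in> ?M. x \<in> m}))"
      using finD by (rule card_UN_le)
    also have "\<dots> \<le> (\<Sum>x\<in>D. card {m \<in> ?M. x \<in> m})"
      using finM by (intro sum_mono card_image_le) auto
    finally have "real (card {T \<in> nset (V - ?F) 3. card (T \<inter> A) = 1}) \<le> real (\<Sum>x\<in>D. card {m \<in> ?M. x \<in> m})"
      by (rule of_nat_mono)
    also have "\<dots> = (\<Sum>x\<in>D. real (card {m \<in> ?M. x \<in> m}))" by simp
    also have "\<dots> \<le> (\<Sum>x\<in>D. 24 / 10000 * real n ^ 3)"
      using D deg by (intro sum_mono) auto
    also have "\<dots> = 72 / 10000 * real n ^ 3" using D by simp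
    finally have "3 / 100 * real n ^ 3 \<le> 72 / 10000 * real n ^ 3" using many by linarith
    moreover have "real n ^ 3 > 0" using large by simp
    ultimately show False by simp
  qed
  then obtain T where T: "T \<in> nset (V - ?F) 3" "D \<subseteq> nbr E T" by blast
  have "insert w D = e" "w \<notin> D" using w D by auto
  moreover have "w \<notin> T" using T w by (auto simp: nset_def)
  ultimately have "F7_on E (insert w (T \<union> D))" using T D e by (intro F7_onI) (auto simp: nset_def)
  moreover have "insert w (T \<union> D) \<inter> F = {}" using F(3) T(1) D w by (auto simp: nset_def)
  ultimately show "\<exists>X. F7_on E X \<and> X \<inter> F = {}" by blast
qed

text \<open>An edge that is not 2-2 has three vertices in one of the two parts, so interchanging the
  parts reduces to the heavy case.\<close>

lemma bad_edge_seed: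
  assumes e: "e \<in> E" "e \<subseteq> V - L" "card (e \<inter> A) \<noteq> 2" and L: "finite L"
    and size: "real (card L) + real q + 4 \<le> real n / 100"
    and deg: "\<And>x. x \<in> e \<Longrightarrow> real (card {m \<in> missing (V - L) E A. x \<in> m}) \<le> 24 / 10000 * real n ^ 3"
  shows "seed E q e"
proof (cases "3 \<le> card (e \<inter> A)")
  case True
  then show ?thesis using heavy_edge_seed assms by blast
next
  case False
  interpret sw: near_cut V E "V - A" n by (rule swap)
  have e4: "finite e" "card e = 4" "e \<subseteq> V" using edge e by auto
  then have "3 \<le> card (e \<inter> (V - A))" using False e(3) card_compl_Int[of e V A] by auto
  moreover have "missing (V - L) E (V - A) = missing (V - L) E A"
  proof -
    have "card (m \<inter> (V - A)) = 2 \<longleftrightarrow> card (m \<inter> A) = 2" if "m \<in> nset (V - L) 4" for m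
    proof -
      have "finite m" "m \<subseteq> V" "card m = 4"
        using that finV nset_mem_finite[of "V - L" m 4] by (auto simp: nset_def)
      moreover from this have "card (m \<inter> A) \<le> 4" by (metis card_mono inf_le1)
      ultimately show ?thesis using card_compl_Int[of m V A] by auto
    qed
    then show ?thesis by (auto simp: missing_def)
  qed
  ultimately show ?thesis using sw.heavy_edge_seed[OF e(1,2) _ L size] deg by simp
qed

end

section \<open>Packings and maximum cuts\<close>

text \<open>Copies are recorded by their vertex sets. These are nonempty, so disjoint copies are
  distinct and a set of them suffices in place of an indexed family.\<close>

definition packing :: "'a set set \<Rightarrow> nat \<Rightarrow> bool" where
  "packing E k \<longleftrightarrow> (\<exists>\<X>. finite \<X> \<and> card \<X> = k \<and> pairwise disjnt \<X> \<and> (\<forall>X\<in>\<X>. F7_on E X))"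

text \<open>With \<open>P\<close> inside \<open>V - K\<close> this is the edge set of the join of a
  complete 4-graph on \<open>K\<close> with a 2-2 graph on the rest. In general \<open>P\<close> may
  meet \<open>K\<close>, since \<open>P\<close> is consulted only for sets disjoint from
  \<open>K\<close>.\<close>

definition join_sets :: "'a set \<Rightarrow> 'a set \<Rightarrow> 'a set \<Rightarrow> 'a set set" where
  "join_sets V K P = {e \<in> nset V 4. e \<inter> K \<noteq> {} \<or> card (e \<inter> P) = 2}"

lemma F7_on_finite: "F7_on E X \<Longrightarrow> finite X \<and> X \<noteq> {}"
  using F7_on_card[of E X] by (metis card.empty card.infinite zero_neq_numeral)

lemma packing_antimono:
  assumes "packing E k" "j \<le> k"
  shows "packing E j"
proof -
  obtain \<X> where X: "finite \<X>" "card \<X> = k" "pairwise disjnt \<X>" "\<forall>X\<in>\<X>. F7_on E X"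
    using assms(1) unfolding packing_def by blast
  then obtain \<Y> where "\<Y> \<subseteq> \<X>" "card \<Y> = j" using assms(2) obtain_subset_with_card_n by metis
  then show ?thesis unfolding packing_def using X
    by (intro exI[of _ \<Y>]) (auto intro: pairwise_subset finite_subset)
qed

text \<open>Greedy choice: each copy avoids \<open>F\<close> and the seeds still waiting, and is
  then added to \<open>F\<close>. A seed of at most 7 vertices is exchanged for a copy of exactly 7,
  so the forbidden set never exceeds \<open>q\<close>.\<close>

lemma packing_of_seeds:
  assumes "finite \<S>" "pairwise disjnt \<S>" "\<And>S. S \<in> \<S> \<Longrightarrow> seed E q S \<and> finite S \<and> card S \<le> 7"
    and "finite F" "F \<inter> \<Union>\<S> = {}" "card F + 7 * card \<S> \<le> q"
  shows "\<exists>\<X>. finite \<X> \<and> card \<X> = card \<S> \<and> pairwise disjnt \<X> \<and> (\<forall>X\<in>\<X>. F7_on E X \<and> X \<inter> F = {})"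
  using assms
proof (induction \<S> arbitrary: F rule: finite_induct)
  case empty
  then show ?case by (intro exI[of _ "{}"]) auto
next
  case (insert S \<S>)
  have fin: "finite (\<Union>\<S>)" using insert.hyps insert.prems(2) by auto
  have "card (\<Union>\<S>) \<le> (\<Sum>S\<in>\<S>. card S)" by (rule card_Union_le_sum_card)
  also have "\<dots> \<le> (\<Sum>S\<in>\<S>. 7)" using insert.prems(2) by (intro sum_mono) auto
  finally have "card (F \<union> \<Union>\<S>) \<le> card F + 7 * card \<S>" using card_Un_le[of F "\<Union>\<S>"] by simp
  then have "card (F \<union> \<Union>\<S>) \<le> q" using insert by simp
  moreover have "S \<inter> \<Union>\<S> = {}"
    using insert.prems(1) insert.hyps by (auto simp: pairwise_insert disjnt_def)
  then have "(F \<union> \<Union>\<S>) \<inter> S = {}" using insert.prems(4) by auto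
  moreover have "seed E q S" using insert.prems(2) by simp
  ultimately obtain X where X: "F7_on E X" "X \<inter> (F \<union> \<Union>\<S>) = {}"
    unfolding seed_def using fin insert.prems(3) by blast
  have finX: "finite X" "card X = 7" "X \<noteq> {}" using F7_on_finite[OF X(1)] F7_on_card[OF X(1)] by auto
  have "\<exists>\<X>. finite \<X> \<and> card \<X> = card \<S> \<and> pairwise disjnt \<X> \<and> (\<forall>Y\<in>\<X>. F7_on E Y \<and> Y \<inter> (F \<union> X) = {})"
  proof (rule insert.IH)
    show "pairwise disjnt \<S>" using insert.prems(1) by (auto simp: pairwise_insert)
    show "card (F \<union> X) + 7 * card \<S> \<le> q"
      using card_Un_le[of F X] finX insert.prems(5) insert.hyps by simp
    show "(F \<union> X) \<inter> \<Union>\<S> = {}" using insert.prems(4) X(2) by auto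
  qed (use insert.prems finX in auto)
  then obtain \<X> where \<X>: "finite \<X>" "card \<X> = card \<S>" "pairwise disjnt \<X>"
    "\<forall>Y\<in>\<X>. F7_on E Y \<and> Y \<inter> (F \<union> X) = {}" by blast
  have "X \<notin> \<X>" using \<X>(4) finX(3) by blast
  moreover have "pairwise disjnt (insert X \<X>)" using \<X> by (auto simp: pairwise_insert disjnt_def)
  ultimately show ?case using \<X> X insert.hyps by (intro exI[of _ "insert X \<X>"]) auto
qed

lemma card_seeds_le:
  assumes "finite \<S>" "pairwise disjnt \<S>"
    and "\<And>S. S \<in> \<S> \<Longrightarrow> seed E (7 * (t + 1)) S \<and> finite S \<and> card S \<le> 7" and "\<not> packing E (t + 1)"
  shows "card \<S> \<le> t"
proof (rule ccontr)
  assume "\<not> ?thesis"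
  then obtain \<S>' where S': "\<S>' \<subseteq> \<S>" "card \<S>' = t + 1" using obtain_subset_with_card_n[of "t + 1" \<S>] by auto
  have "\<exists>\<X>. finite \<X> \<and> card \<X> = card \<S>' \<and> pairwise disjnt \<X> \<and> (\<forall>X\<in>\<X>. F7_on E X \<and> X \<inter> {} = {})"
    using S' assms by (intro packing_of_seeds[where q = "7 * (t + 1)"]) (auto intro: finite_subset pairwise_subset)
  then show False using assms(4) S'(2) unfolding packing_def by auto
qed

text \<open>The union of a maximum packing meets every copy, and each of its at most
  \<open>t\<close> members has 7 vertices.\<close>

lemma ex_F7_cover:
  assumes V: "finite V" and E: "E \<subseteq> nset V 4" and np: "\<not> packing E (t + 1)"
  shows "\<exists>U. finite U \<and> card U \<le> 7 * t \<and> (\<forall>X. \<not> F7_on {e \<in> E. e \<inter> U = {}} X)"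
proof -
  have "packing E 0" unfolding packing_def by (intro exI[of _ "{}"]) auto
  moreover have bd: "k < Suc t" if "packing E k" for k
    using packing_antimono[OF that, of "t + 1"] np by (cases "k < Suc t") auto
  ultimately have "\<exists>m. packing E m \<and> (\<forall>k. packing E k \<longrightarrow> k \<le> m)"
    using ex_has_greatest_nat[of "packing E" 0 "\<lambda>k. k" "Suc t"] by blast
  then obtain m where m: "packing E m" "\<And>k. packing E k \<Longrightarrow> k \<le> m" "m \<le> t"
    using bd by fastforce
  then obtain \<X> where X: "finite \<X>" "card \<X> = m" "pairwise disjnt \<X>" "\<forall>X\<in>\<X>. F7_on E X"
    unfolding packing_def by blast
  define U where "U = \<Union>\<X>"
  have finU: "finite U" using X F7_on_finite by (auto simp: U_def)
  have "card U \<le> (\<Sum>X\<in>\<X>. card X)" unfolding U_def by (rule card_Union_le_sum_card)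
  also have "\<dots> = (\<Sum>X\<in>\<X>. 7)" using X F7_on_card by (intro sum.cong) auto
  finally have "card U \<le> 7 * t" using X m by simp
  moreover have "\<not> F7_on {e \<in> E. e \<inter> U = {}} Y" for Y
  proof
    assume Y: "F7_on {e \<in> E. e \<inter> U = {}} Y"
    have "Y \<subseteq> V - U" using E by (intro F7_on_subset[OF Y]) (auto simp: nset_def)
    then have disj: "Y \<inter> U = {}" by auto
    have YE: "F7_on E Y" by (rule F7_on_mono[OF Y]) auto
    have "Y \<noteq> {}" using F7_on_finite[OF YE] by simp
    then have "Y \<notin> \<X>" using disj by (auto simp: U_def)
    then have "packing E (Suc m)"
      unfolding packing_def using X YE disj
      by (intro exI[of _ "insert Y \<X>"]) (auto simp: pairwise_insert disjnt_def U_def)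
    then show False using m(2)[of "Suc m"] by simp
  qed
  ultimately show ?thesis using finU by blast
qed

text \<open>In a copy avoiding \<open>K\<close> all edges are 2-2. Every vertex of \<open>D\<close>
  completes \<open>T\<close> to a 2-2 set, so \<open>D\<close> lies entirely on one side, and then
  \<open>insert w D\<close> is not 2-2.\<close>

lemma join_sets_F7_on_meets:
  assumes "F7_on (join_sets V K P) X"
  shows "X \<inter> K \<noteq> {}"
proof
  assume XK: "X \<inter> K = {}"
  obtain T D w where *: "card T = 3" "card D = 3" "D \<subseteq> nbr (join_sets V K P) T" "w \<notin> D"
    "insert w D \<in> join_sets V K P" "X = insert w (T \<union> D)"
    using assms unfolding F7_on_def by blast
  have fin: "finite T" "finite D" using * by (auto intro: card_ge_0_finite)
  have side: "x \<in> P \<longleftrightarrow> card (T \<inter> P) = 1" if "x \<in> D" for x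
  proof -
    have "x \<notin> T" "insert x T \<in> join_sets V K P" using that * by (auto simp: nbr_def)
    moreover have "insert x T \<inter> K = {}" using XK * that by auto
    ultimately have "x \<notin> T" "card (insert x T \<inter> P) = 2" by (auto simp: join_sets_def)
    then show ?thesis using fin by (auto simp: Int_insert_left split: if_splits)
  qed
  have "insert w D \<inter> K = {}" using XK * by auto
  then have 2: "card (insert w D \<inter> P) = 2" using * by (auto simp: join_sets_def)
  show False
  proof (cases "card (T \<inter> P) = 1")
    case True
    then have "D \<inter> P = D" using side by auto
    then show False using 2 * fin by (auto simp: Int_insert_left split: if_splits)
  next
    case False
    then have "D \<inter> P = {}" using side by auto
    then show False using 2 * fin by (auto simp: Int_insert_left split: if_splits)
  qed
qed

text \<open>Disjoint copies use up distinct vertices of \<open>K\<close>.\<close>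

lemma join_sets_no_packing:
  assumes "finite K"
  shows "\<not> packing (join_sets V K P) (card K + 1)"
proof
  assume "packing (join_sets V K P) (card K + 1)"
  then obtain \<X> where X: "finite \<X>" "card \<X> = card K + 1" "pairwise disjnt \<X>"
    "\<forall>X\<in>\<X>. F7_on (join_sets V K P) X" unfolding packing_def by blast
  then have "\<forall>X\<in>\<X>. \<exists>x. x \<in> X \<inter> K" using join_sets_F7_on_meets by blast
  then obtain f where f: "\<And>X. X \<in> \<X> \<Longrightarrow> f X \<in> X \<inter> K" by metis
  have "inj_on f \<X>"
  proof (rule inj_onI)
    fix X Y assume "X \<in> \<X>" "Y \<in> \<X>" "f X = f Y"
    then show "X = Y" using f[of X] f[of Y] X(3) by (auto simp: pairwise_def disjnt_def)
  qed
  moreover have "f ` \<X> \<subseteq> K" using f by auto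
  ultimately have "card \<X> \<le> card K" using assms by (intro card_inj_on_le)
  then show False using X by simp
qed

section \<open>Maximum cuts and degrees in the non-2-2 edges\<close>

definition cut_size :: "'a set set \<Rightarrow> 'a set \<Rightarrow> nat" where
  "cut_size E A = card {e \<in> E. card (e \<inter> A) = 2}"

lemma cut_size_split:
  assumes "finite E"
  shows "cut_size E A = card {e \<in> E. v \<notin> e \<and> card (e \<inter> A) = 2} + card {e \<in> E. v \<in> e \<and> card (e \<inter> A) = 2}"
proof -
  have "{e \<in> E. card (e \<inter> A) = 2} = {e \<in> E. v \<notin> e \<and> card (e \<inter> A) = 2} \<union> {e \<in> E. v \<in> e \<and> card (e \<inter> A) = 2}"
    by auto
  then show ?thesis unfolding cut_size_def using assms by (simp add: card_Un_disjoint disjoint_iff)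
qed

text \<open>Only edges through \<open>v\<close> change status when \<open>v\<close> moves: on the
  side of \<open>A\<close> they need one further vertex in \<open>A\<close>, on the other side
  two.\<close>

lemma cut_size_insert:
  assumes "finite E" "\<And>e. e \<in> E \<Longrightarrow> finite e" "v \<notin> A"
  shows "cut_size E (insert v A) = card {e \<in> E. v \<notin> e \<and> card (e \<inter> A) = 2} + link_deg E A v 1"
    and "cut_size E A = card {e \<in> E. v \<notin> e \<and> card (e \<inter> A) = 2} + link_deg E A v 2"
proof -
  have "card (e \<inter> insert v A) = 2 \<longleftrightarrow> card ((e - {v}) \<inter> A) = 1" if "e \<in> E" "v \<in> e" for e
  proof -
    have "e \<inter> insert v A = insert v ((e - {v}) \<inter> A)" using that by auto
    then show ?thesis using assms(2)[OF that(1)] by simp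
  qed
  then have "{e \<in> E. v \<in> e \<and> card (e \<inter> insert v A) = 2} = {e \<in> E. v \<in> e \<and> card ((e - {v}) \<inter> A) = 1}"
    by auto
  moreover have "{e \<in> E. v \<notin> e \<and> card (e \<inter> insert v A) = 2} = {e \<in> E. v \<notin> e \<and> card (e \<inter> A) = 2}"
    by auto
  ultimately show "cut_size E (insert v A) = card {e \<in> E. v \<notin> e \<and> card (e \<inter> A) = 2} + link_deg E A v 1"
    using cut_size_split[OF assms(1), of "insert v A" v] by (simp add: link_deg_def)
  have "(e - {v}) \<inter> A = e \<inter> A" for e using assms(3) by auto
  then show "cut_size E A = card {e \<in> E. v \<notin> e \<and> card (e \<inter> A) = 2} + link_deg E A v 2"
    using cut_size_split[OF assms(1), of A v] by (simp add: link_deg_def)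
qed

text \<open>A vertex that is not rich has few link triples of one mixed type, and by maximality of the cut this
  is the type producing non-2-2 edges.\<close>

lemma (in near_cut) bad_degree_le:
  assumes max: "\<And>A'. A' \<subseteq> V \<Longrightarrow> cut_size E A' \<le> cut_size E A"
    and v: "v \<in> V" "\<not> rich V E A v"
  shows "real (card {e \<in> E. v \<in> e \<and> card (e \<inter> A) \<noteq> 2}) \<le> 3 * (real n ^ 3 / 10000)"
proof -
  have fine: "e \<in> E \<Longrightarrow> finite e" for e using edge by blast
  let ?m = "real n ^ 3 / 10000"
  let ?S = "\<lambda>i. {e \<in> E. v \<in> e \<and> card ((e - {v}) \<inter> A) = i}"
  have nr: "link_deg E A v 3 \<le> ?m" "link_deg E A v 0 \<le> ?m" "link_deg E A v 1 \<le> ?m \<or> link_deg E A v 2 \<le> ?m"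
    using v(2) n by (auto simp: rich_def Let_def not_less)
  have three: "card ((e - {v}) \<inter> A) \<le> 3" if "e \<in> E" "v \<in> e" for e
    using edge[OF that(1)] that(2) card_mono[of "e - {v}" "(e - {v}) \<inter> A"] by simp
  have bound: "real (card {e \<in> E. v \<in> e \<and> card (e \<inter> A) \<noteq> 2}) \<le> 3 * ?m"
    if sub: "{e \<in> E. v \<in> e \<and> card (e \<inter> A) \<noteq> 2} \<subseteq> ?S 0 \<union> ?S j \<union> ?S 3" and j: "real (link_deg E A v j) \<le> ?m" for j
  proof -
    have "card {e \<in> E. v \<in> e \<and> card (e \<inter> A) \<noteq> 2} \<le> card (?S 0 \<union> ?S j \<union> ?S 3)"
      using sub finE by (intro card_mono) auto
    also have "\<dots> \<le> card (?S 0) + card (?S j) + card (?S 3)"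
      by (meson add_le_mono card_Un_le le_refl order_trans)
    finally have "real (card {e \<in> E. v \<in> e \<and> card (e \<inter> A) \<noteq> 2}) \<le> real (link_deg E A v 0 + link_deg E A v j + link_deg E A v 3)"
      unfolding link_deg_def by (rule of_nat_mono)
    then show ?thesis using nr(1,2) j by simp
  qed
  show ?thesis
  proof (cases "v \<in> A")
    case True
    have "cut_size E (A - {v}) \<le> cut_size E A" using AV by (intro max) auto
    then have "cut_size E (A - {v}) \<le> cut_size E (insert v (A - {v}))" using True by (simp add: insert_absorb)
    then have "link_deg E (A - {v}) v 2 \<le> link_deg E (A - {v}) v 1"
      using cut_size_insert[OF finE fine, of v "A - {v}"] by simp
    moreover have "link_deg E (A - {v}) v i = link_deg E A v i" for i
    proof -
      have "(e - {v}) \<inter> (A - {v}) = (e - {v}) \<inter> A" for e by auto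
      then show ?thesis by (simp add: link_deg_def)
    qed
    ultimately have "real (link_deg E A v 2) \<le> ?m" using nr(3) by auto
    moreover have "{e \<in> E. v \<in> e \<and> card (e \<inter> A) \<noteq> 2} \<subseteq> ?S 0 \<union> ?S 2 \<union> ?S 3"
    proof
      fix e assume e: "e \<in> {e \<in> E. v \<in> e \<and> card (e \<inter> A) \<noteq> 2}"
      have "e \<inter> A = insert v ((e - {v}) \<inter> A)" using e True by auto
      then have "card (e \<inter> A) = Suc (card ((e - {v}) \<inter> A))" using fine[of e] e by simp
      then have "card ((e - {v}) \<inter> A) \<noteq> 1" using e by auto
      then have "card ((e - {v}) \<inter> A) = 0 \<or> card ((e - {v}) \<inter> A) = 2 \<or> card ((e - {v}) \<inter> A) = 3"
        using three[of e] e by auto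
      then show "e \<in> ?S 0 \<union> ?S 2 \<union> ?S 3" using e by auto
    qed
    ultimately show ?thesis using bound by blast
  next
    case False
    have "cut_size E (insert v A) \<le> cut_size E A" using AV v by (intro max) auto
    then have "link_deg E A v 1 \<le> link_deg E A v 2"
      using cut_size_insert[OF finE fine False] by simp
    then have "real (link_deg E A v 1) \<le> ?m" using nr(3) by auto
    moreover have "{e \<in> E. v \<in> e \<and> card (e \<inter> A) \<noteq> 2} \<subseteq> ?S 0 \<union> ?S 1 \<union> ?S 3"
    proof
      fix e assume e: "e \<in> {e \<in> E. v \<in> e \<and> card (e \<inter> A) \<noteq> 2}"
      have "(e - {v}) \<inter> A = e \<inter> A" using False by auto
      then have "card ((e - {v}) \<inter> A) \<noteq> 2" using e by simp
      then have "card ((e - {v}) \<inter> A) = 0 \<or> card ((e - {v}) \<inter> A) = 1 \<or> card ((e - {v}) \<inter> A) = 3"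
        using three[of e] e by auto
      then show "e \<in> ?S 0 \<union> ?S 1 \<union> ?S 3" using e by auto
    qed
    ultimately show ?thesis using bound by blast
  qed
qed

lemma sum_star_le:
  assumes V: "finite V" and M: "M \<subseteq> nset V 4" and Z: "finite Z"
  shows "(\<Sum>z\<in>Z. card {m \<in> M. z \<in> m}) \<le> 4 * card M"
proof -
  have fin: "finite M" using V M by (meson finite_subset nset_finite)
  have "(\<Sum>z\<in>Z. card {m \<in> M. z \<in> m}) = (\<Sum>m\<in>M. card {z \<in> Z. z \<in> m})"
    by (rule sum_multicount_gen[symmetric]) (use fin Z in auto)
  also have "\<dots> \<le> (\<Sum>m\<in>M. 4)"
  proof (rule sum_mono)
    fix m assume "m \<in> M"
    then have "finite m" "card m = 4" using M V nset_mem_finite[of V m 4] by (auto simp: nset_def)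
    then show "card {z \<in> Z. z \<in> m} \<le> 4" using card_mono[of m "{z \<in> Z. z \<in> m}"] by auto
  qed
  finally show ?thesis by simp
qed

section \<open>Structure of extremal edge sets\<close>

text \<open>The competitor is \<open>join_sets\<close> with a balanced \<open>P\<close>, for which
  the balanced 2-2 sets alone already give the bound.\<close>

lemma extremal_card_ge:
  assumes V: "finite V" and t: "t \<le> card V"
    and max: "\<And>E'. E' \<subseteq> nset V 4 \<Longrightarrow> \<not> packing E' (t + 1) \<Longrightarrow> card E' \<le> card E"
  shows "real (card E) \<ge> real (card V) ^ 4 / 64 - real (card V) ^ 3"
proof (cases "card V < 4")
  case True
  then have "real (card V) ^ 3 * real (card V) \<le> real (card V) ^ 3 * 4" by (intro mult_left_mono) auto
  moreover have "real (card V) ^ 4 = real (card V) ^ 3 * real (card V)" by (simp add: eval_nat_numeral)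
  moreover have "real (card V) ^ 3 \<ge> 0" by simp
  ultimately have "real (card V) ^ 4 / 64 - real (card V) ^ 3 \<le> 0" by linarith
  then show ?thesis using of_nat_0_le_iff[of "card E"] by linarith
next
  case False
  define n where "n = card V"
  define h where "h = n div 2"
  have n4: "n \<ge> 4" using False by (simp add: n_def)
  obtain K where K: "K \<subseteq> V" "card K = t" using t obtain_subset_with_card_n by metis
  have "h \<le> card V" by (simp add: h_def n_def)
  then obtain P where P: "P \<subseteq> V" "card P = h" using obtain_subset_with_card_n by metis
  have finK: "finite K" "finite P" using K P V finite_subset by blast+
  have cP: "card (V - P) = n - h" using P finK by (simp add: card_Diff_subset n_def)
  \<comment> \<open>All 2-2 sets belong to the competitor even if \<open>K\<close> and
    \<open>P\<close> overlap.\<close>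
  have "{e \<in> nset V 4. card (e \<inter> P) = 2} \<subseteq> join_sets V K P" by (auto simp: join_sets_def)
  then have "card {e \<in> nset V 4. card (e \<inter> P) = 2} \<le> card (join_sets V K P)"
    using V by (intro card_mono) (auto simp: join_sets_def)
  also have "\<dots> \<le> card E" using join_sets_no_packing[OF finK(1), of V P] K by (intro max) (auto simp: join_sets_def)
  finally have "(h choose 2) * ((n - h) choose 2) \<le> card E"
    using card_nset_split[OF V P(1), of 2 4] P cP by simp
  then have "real ((h choose 2) * ((n - h) choose 2)) \<le> real (card E)" by (rule of_nat_mono)
  then have E: "real (h choose 2) * real ((n - h) choose 2) \<le> real (card E)" by simp
  have "2 * h \<le> n" "n \<le> 2 * h + 1" unfolding h_def by linarith+
  then have "real (2 * h) \<le> real n" "real n \<le> real (2 * h + 1)" by (simp_all only: of_nat_le_iff)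
  then have h: "real h \<ge> (real n - 1) / 2" "real h \<le> real n / 2" by simp_all
  have h2: "real (n - h) \<ge> real n / 2" using h(2) by (simp add: h_def of_nat_diff)
  have "real (h choose 2) \<ge> ((real n - 1) / 2) * ((real n - 3) / 2) / 2"
    unfolding choose2 using h n4 by (intro divide_right_mono mult_mono) auto
  moreover have "real ((n - h) choose 2) \<ge> (real n / 2) * ((real n - 2) / 2) / 2"
    unfolding choose2 using h2 n4 by (intro divide_right_mono mult_mono) auto
  ultimately have 1: "real (h choose 2) * real ((n - h) choose 2)
      \<ge> (((real n - 1) / 2) * ((real n - 3) / 2) / 2) * ((real n / 2) * ((real n - 2) / 2) / 2)"
    using n4 by (intro mult_mono) auto
  have 2: "(((real n - 1) / 2) * ((real n - 3) / 2) / 2) * ((real n / 2) * ((real n - 2) / 2) / 2)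
     = (real n ^ 4 - 6 * real n ^ 3 + real n * (11 * real n - 6)) / 64"
    by (simp add: eval_nat_numeral field_simps)
  have "(real n ^ 4 - 6 * real n ^ 3 + real n * (11 * real n - 6)) / 64 \<le> real (card E)"
    using order_trans[OF 1 E] unfolding 2 .
  then have "real n ^ 4 - 6 * real n ^ 3 + real n * (11 * real n - 6) \<le> 64 * real (card E)" by simp
  moreover have "real n * (11 * real n - 6) \<ge> 0" using n4 by simp
  moreover have "real n ^ 3 \<ge> 0" by simp
  ultimately have "real n ^ 4 - 6 * real n ^ 3 \<le> 64 * real (card E)" "real n ^ 3 \<ge> 0" by argo+
  then show ?thesis unfolding n_def by linarith
qed

lemma ex_max_cut:
  assumes V: "finite V"
  shows "\<exists>A \<subseteq> V. \<forall>A' \<subseteq> V. cut_size E A' \<le> cut_size E A"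
proof -
  have "cut_size E A < Suc (Max (cut_size E ` Pow V))" if "A \<subseteq> V" for A
    using V that by (simp add: less_Suc_eq_le)
  then show ?thesis
    using ex_has_greatest_nat[of "\<lambda>A. A \<subseteq> V" "{}" "cut_size E" "Suc (Max (cut_size E ` Pow V))"] by blast
qed

text \<open>There are at most \<open>(a * b)^2 / 4\<close> sets that are 2-2, and this is at most
  \<open>n^4 / 64\<close>. A cut close to that value leaves few sets missing and forces
  \<open>a\<close> and \<open>b\<close> to be close to each other.\<close>

lemma near_cut_of_large_cut:
  assumes V: "finite V" and E: "E \<subseteq> nset V 4" and A: "A \<subseteq> V" and n: "n = card V" "real n \<ge> 1000000"
    and cut: "real (cut_size E A) \<ge> real n ^ 4 / 64 - real n ^ 4 / 10000000000"
  shows "near_cut V E A n"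
proof -
  define a where "a = real (card A)"
  define b where "b = real (card (V - A))"
  have "card A + card (V - A) = n" using A V finite_subset[OF A V] n card_mono[OF V A] by (simp add: card_Diff_subset)
  then have ab: "a + b = real n" unfolding a_def b_def by linarith
  define C where "C = {e \<in> nset V 4. card (e \<inter> A) = 2}"
  have finC: "finite C" using V by (simp add: C_def)
  have "real (card C) = real (card A choose 2) * real (card (V - A) choose 2)"
    unfolding C_def using card_nset_split[OF V A, of 2 4] by simp
  also have "\<dots> \<le> (a ^ 2 / 2) * (b ^ 2 / 2)"
    unfolding a_def b_def by (intro mult_mono choose2_le) auto
  finally have C: "real (card C) \<le> (a * b) ^ 2 / 4" by (simp add: power_mult_distrib)
  let ?D = "{e \<in> E. card (e \<inter> A) = 2}"
  have D: "?D \<subseteq> C" using E by (auto simp: C_def)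
  have "missing V E A = C - ?D" by (auto simp: missing_def C_def)
  then have "real (card (missing V E A)) = real (card C) - real (cut_size E A)"
    using card_Diff_subset[of ?D C] D finC finite_subset[OF D finC] card_mono[OF finC D]
    by (simp add: cut_size_def of_nat_diff)
  have "real (cut_size E A) \<le> real (card C)" using card_mono[OF finC D] by (simp add: cut_size_def)
  then have lower: "(a * b) ^ 2 / 4 \<ge> real n ^ 4 / 64 - real n ^ 4 / 10000000000" using C cut by linarith
  have n4pos: "real n ^ 4 > 0" using n by simp
  have nn: "a \<ge> 0" "b \<ge> 0" by (auto simp: a_def b_def)
  have amgm: "a * b = (real n ^ 2 - (a - b) ^ 2) / 4"
    unfolding ab[symmetric] by (simp add: power2_eq_square algebra_simps)
  have "a * b \<le> real n ^ 2 / 4" unfolding amgm by simp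
  then have "(a * b) ^ 2 \<le> (real n ^ 2 / 4) ^ 2" using nn by (intro power_mono) auto
  moreover have "(real n ^ 2 / 4) ^ 2 = real n ^ 4 / 16" by (simp add: eval_nat_numeral)
  ultimately have up: "(a * b) ^ 2 / 4 \<le> real n ^ 4 / 64" by linarith
  have close: "\<bar>a - b\<bar> \<le> real n / 10"
  proof (rule ccontr)
    assume "\<not> ?thesis"
    then have "\<bar>a - b\<bar> ^ 2 \<ge> (real n / 10) ^ 2" using n by (intro power_mono) auto
    then have "(a - b) ^ 2 \<ge> real n ^ 2 / 100" by (simp add: power_divide)
    then have "a * b \<le> (99 / 400) * real n ^ 2" unfolding amgm by simp
    then have "(a * b) ^ 2 \<le> ((99 / 400) * real n ^ 2) ^ 2" using nn by (intro power_mono) auto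
    also have "\<dots> = (9801 / 160000) * real n ^ 4" by (simp add: eval_nat_numeral)
    finally show False using lower n4pos by linarith
  qed
  show ?thesis
  proof
    show "45 / 100 * real n \<le> real (card A)" "45 / 100 * real n \<le> real (card (V - A))"
      using close ab unfolding a_def[symmetric] b_def[symmetric] by linarith+
    show "real (card (missing V E A)) \<le> real n ^ 4 / 10000000000"
      using \<open>real (card (missing V E A)) = _\<close> C up cut by linarith
  qed (use assms in auto)
qed

text \<open>Deleting a cover of at most \<open>7 * t\<close> vertices costs at most
  \<open>7 * t * n^3\<close> edges and leaves no copy, so stability applies to the
  remainder.\<close>

lemma extremal_has_large_cut:
  assumes V: "finite V" and E: "E \<subseteq> nset V 4" and np: "\<not> packing E (t + 1)"
    and n: "n = card V" "real n \<ge> 10 ^ 27" and t: "10 ^ 27 * real t \<le> real n"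
    and lower: "real (card E) \<ge> real n ^ 4 / 64 - real n ^ 3"
  shows "\<exists>A \<subseteq> V. real (cut_size E A) \<ge> real n ^ 4 / 64 - real n ^ 4 / 10000000000"
proof -
  obtain U where U: "finite U" "card U \<le> 7 * t" "\<And>X. \<not> F7_on {e \<in> E. e \<inter> U = {}} X"
    using ex_F7_cover[OF V E np] by blast
  define E0 where "E0 = {e \<in> E. e \<inter> U = {}}"
  have E0: "E0 \<subseteq> nset V 4" using E by (auto simp: E0_def)
  have finE: "finite E" using V E by (meson finite_subset nset_finite)
  have "card (E - E0) \<le> card {e \<in> nset V 4. e \<inter> U \<noteq> {}}"
    using V E by (intro card_mono) (auto simp: E0_def)
  also have "\<dots> \<le> card U * n ^ 3" using card_nset_meet_le[OF V U(1), of 4] n by simp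
  also have "\<dots> \<le> 7 * t * n ^ 3" using U by (intro mult_right_mono) auto
  finally have "card E \<le> card E0 + 7 * t * n ^ 3"
    using finE card_Un_le[of E0 "E - E0"] by (auto simp: E0_def Un_absorb1)
  then have "real (card E) \<le> real (card E0 + 7 * t * n ^ 3)" by (rule of_nat_mono)
  then have cE0: "real (card E) \<le> real (card E0) + 7 * (real t * real n ^ 3)" by simp
  have "10 ^ 27 * real t * real n ^ 3 \<le> real n * real n ^ 3" using t by (intro mult_right_mono) auto
  then have t3: "1000000000000000000000000000 * (real t * real n ^ 3) \<le> real n ^ 4" by (simp add: eval_nat_numeral)
  have "10 ^ 27 * real n ^ 3 \<le> real n * real n ^ 3" using n by (intro mult_right_mono) auto
  then have n3: "1000000000000000000000000000 * real n ^ 3 \<le> real n ^ 4" by (simp add: eval_nat_numeral)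
  have n4pos: "real n ^ 4 > 0" using n by simp
  \<comment> \<open>The gain \<open>\<epsilon>\<^sup>2/32\<close> of the stability bound must beat the error terms of order \<open>t/n\<close> and \<open>1/n\<close>,
    which are at most \<open>10\<close> to the power \<open>-27\<close>.\<close>
  let ?eps = "1 / 100000000000 :: real"
  have "(3 / 8 - ?eps ^ 2 / 32) * real n ^ 4 = 3 / 8 * real n ^ 4 - real n ^ 4 / 320000000000000000000000"
    by (simp add: power2_eq_square left_diff_distrib)
  then have "24 * real (card E0) > (3 / 8 - ?eps ^ 2 / 32) * real (card V) ^ 4 + 147 * real (card V) ^ 3"
    unfolding n(1)[symmetric] using cE0 t3 n3 n4pos lower by linarith
  then obtain A where A: "A \<subseteq> V" "real (card {e \<in> E0. card (e \<inter> A) = 2})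
     \<ge> real (card E0) - 6 * real (card V) ^ 3 - ?eps * real (card V) ^ 4"
    using F7_free_stability[OF V E0, of ?eps] U(3) by (auto simp: E0_def)
  have "card {e \<in> E0. card (e \<inter> A) = 2} \<le> cut_size E A"
    unfolding cut_size_def using finE by (intro card_mono) (auto simp: E0_def)
  then have "real (card {e \<in> E0. card (e \<inter> A) = 2}) \<le> real (cut_size E A)" by simp
  then have "real (cut_size E A) \<ge> real n ^ 4 / 64 - real n ^ 4 / 10000000000"
    using A(2) cE0 t3 n3 n4pos lower unfolding n(1)[symmetric] by linarith
  then show ?thesis using A by blast
qed

text \<open>Against \<open>join_sets\<close> on a \<open>t\<close>-set, the graph loses the missing
  sets forced by \<open>Z\<close> and the sets gained by enlarging \<open>L\<close>. The bad edges
  cannot compensate unless all these quantities vanish.\<close>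

lemma extremal_structure:
  assumes V: "finite V" and E: "E \<subseteq> nset V 4" and np: "\<not> packing E (t + 1)"
    and max: "\<And>E'. E' \<subseteq> nset V 4 \<Longrightarrow> \<not> packing E' (t + 1) \<Longrightarrow> card E' \<le> card E"
    and large: "real (card V) \<ge> 10 ^ 27" and t: "10 ^ 27 * real t \<le> real (card V)"
  shows "\<exists>K P. K \<subseteq> V \<and> card K = t \<and> P \<subseteq> V - K \<and> E = join_sets V K P"
proof -
  define n where "n = card V"
  note nlarge = large[folded n_def] and tn = t[folded n_def]
  have "real t \<le> 10 ^ 27 * real t" by simp
  then have "real t \<le> real (card V)" using t by linarith
  then have tV: "t \<le> card V" by simp
  have low: "real (card E) \<ge> real n ^ 4 / 64 - real n ^ 3"
    unfolding n_def by (rule extremal_card_ge[OF V tV max])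
  obtain A0 where A0: "A0 \<subseteq> V" "real (cut_size E A0) \<ge> real n ^ 4 / 64 - real n ^ 4 / 10000000000"
    using extremal_has_large_cut[OF V E np n_def nlarge tn low] by blast
  obtain A where A: "A \<subseteq> V" "\<And>A'. A' \<subseteq> V \<Longrightarrow> cut_size E A' \<le> cut_size E A"
    using ex_max_cut[OF V] by meson
  have "real (cut_size E A0) \<le> real (cut_size E A)" using A(2)[OF A0(1)] by simp
  then have "real (cut_size E A) \<ge> real n ^ 4 / 64 - real n ^ 4 / 10000000000" using A0(2) by linarith
  then interpret near_cut V E A n
    using nlarge by (intro near_cut_of_large_cut[OF V E A(1) n_def]) auto
  \<comment> \<open>Room for \<open>t + 1\<close> copies with 7 vertices each.\<close>
  define q where "q = 7 * (t + 1)"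
  have q: "real q \<le> 25 / 1000000 * real n" using tn nlarge by (simp add: q_def)
  have n3: "real n ^ 3 > 0" using nlarge by simp
  define L where "L = {v \<in> V. rich V E A v}"
  have LV: "L \<subseteq> V" by (auto simp: L_def)
  have finL: "finite L" using V by (simp add: L_def)
  have Lseed: "seed E q S \<and> finite S \<and> card S \<le> 7" if "S \<in> (\<lambda>v. {v}) ` L" for S
    using that rich_seed[OF q] by (auto simp: L_def)
  have cardsing: "card ((\<lambda>v. {v}) ` L) = card L" by (rule card_image) auto
  have "card ((\<lambda>v. {v}) ` L) \<le> t"
    using finL Lseed np by (intro card_seeds_le[where E = E]) (auto simp: q_def pairwise_def disjnt_def)
  then have Lt: "card L \<le> t" using cardsing by simp
  define W where "W = V - L"
  define M where "M = missing W E A"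
  \<comment> \<open>Vertices of large missing degree; the threshold is the degree hypothesis of
    \<open>bad_edge_seed\<close>, so bad edges avoiding \<open>Z\<close> are seeds.\<close>
  define Z where "Z = {v \<in> W. real (card {m \<in> M. v \<in> m}) > 24 / 10000 * real n ^ 3}"
  define B where "B = {e \<in> E. e \<subseteq> W \<and> card (e \<inter> A) \<noteq> 2}"
  have finW: "finite W" using V by (simp add: W_def)
  have finZ: "finite Z" using finW by (simp add: Z_def)
  have finB: "finite B" using finE by (simp add: B_def)
  have finM: "finite M" using finW by (simp add: M_def missing_def)
  have Bseed: "seed E q e \<and> finite e \<and> card e \<le> 7" if "e \<in> B" "e \<inter> Z = {}" for e
  proof
    have "real (card L) \<le> real t" using Lt by simp
    then have size: "real (card L) + real q + 4 \<le> real n / 100" using q tn nlarge by simp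
    show "seed E q e"
    proof (rule bad_edge_seed[OF _ _ _ finL size])
      fix x assume "x \<in> e"
      then have "x \<in> W" "x \<notin> Z" using that by (auto simp: B_def)
      then show "real (card {m \<in> missing (V - L) E A. x \<in> m}) \<le> 24 / 10000 * real n ^ 3"
        by (auto simp: Z_def M_def W_def)
    qed (use that in \<open>auto simp: B_def W_def\<close>)
    show "finite e \<and> card e \<le> 7" using that edge by (simp add: B_def)
  qed
  \<comment> \<open>The edges of a matching avoid \<open>L\<close>, so together with the singletons
    of \<open>L\<close> they are disjoint seeds, at most \<open>t\<close> in number.\<close>
  define matching where "matching \<M> \<longleftrightarrow> \<M> \<subseteq> {e \<in> B. e \<inter> Z = {}} \<and> pairwise disjnt \<M>" for \<M>
  have mbound: "card L + card \<M> \<le> t" if "matching \<M>" for \<M>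
  proof -
    have fin: "finite \<M>" using that finB by (auto simp: matching_def intro: finite_subset)
    have sub: "e \<subseteq> V - L" if "e \<in> \<M>" for e using \<open>matching \<M>\<close> that by (auto simp: matching_def B_def W_def)
    have dj: "(\<lambda>v. {v}) ` L \<inter> \<M> = {}" using sub by fastforce
    have "card ((\<lambda>v. {v}) ` L \<union> \<M>) \<le> t"
    proof (rule card_seeds_le[where E = E])
      show "pairwise disjnt ((\<lambda>v. {v}) ` L \<union> \<M>)"
      proof (rule pairwiseI)
        fix S S' assume S: "S \<in> (\<lambda>v. {v}) ` L \<union> \<M>" "S' \<in> (\<lambda>v. {v}) ` L \<union> \<M>" "S \<noteq> S'"
        have "disjnt S S'" if "S \<in> \<M>" "S' \<in> \<M>"
          using \<open>matching \<M>\<close> that S(3) unfolding matching_def pairwise_def by blast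
        then show "disjnt S S'" using S sub unfolding disjnt_def by blast
      qed
      fix S assume "S \<in> (\<lambda>v. {v}) ` L \<union> \<M>"
      then show "seed E (7 * (t + 1)) S \<and> finite S \<and> card S \<le> 7"
        using Lseed[of S] Bseed[of S] that by (auto simp: q_def matching_def)
    qed (use fin finL np in auto)
    then show ?thesis using card_Un_disjoint[OF _ fin dj] finL cardsing by simp
  qed
  have "matching {}" by (simp add: matching_def)
  moreover have "card \<M> < Suc t" if "matching \<M>" for \<M> using mbound[OF that] by simp
  ultimately have "\<exists>\<M>. matching \<M> \<and> (\<forall>\<M>'. matching \<M>' \<longrightarrow> card \<M>' \<le> card \<M>)"
    using ex_has_greatest_nat[of matching "{}" card "Suc t"] by blast
  then obtain \<M> where \<M>: "matching \<M>" "\<And>\<M>'. matching \<M>' \<Longrightarrow> card \<M>' \<le> card \<M>" by blast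
  have fin\<M>: "finite \<M>" using \<M>(1) finB by (auto simp: matching_def intro: finite_subset)
  define s where "s = t - card L"
  have M4: "e \<in> \<M> \<Longrightarrow> finite e \<and> card e = 4 \<and> e \<subseteq> W \<and> e \<noteq> {}" for e
    using \<M>(1) edge[of e] by (auto simp: matching_def B_def)
  define Y where "Y = Z \<union> \<Union>\<M>"
  have finY: "finite Y" using finZ fin\<M> M4 by (auto simp: Y_def)
  have YW: "Y \<subseteq> W" using M4 by (auto simp: Y_def Z_def)
  have "card (\<Union>\<M>) \<le> (\<Sum>e\<in>\<M>. card e)" by (rule card_Union_le_sum_card)
  also have "\<dots> = 4 * card \<M>" using M4 by simp
  also have "\<dots> \<le> 4 * s" using mbound[OF \<M>(1)] by (simp add: s_def)
  finally have cY: "card Y \<le> card Z + 4 * s" using card_Un_le[of Z "\<Union>\<M>"] by (simp add: Y_def)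
  \<comment> \<open>A bad edge missing \<open>Y\<close> would avoid \<open>Z\<close> and extend the
    maximum matching.\<close>
  have cover: "e \<inter> Y \<noteq> {}" if "e \<in> B" for e
  proof
    assume eY: "e \<inter> Y = {}"
    have "e \<noteq> {}" using that edge[of e] by (auto simp: B_def)
    then have "e \<notin> \<M>" using eY by (auto simp: Y_def)
    moreover have "matching (insert e \<M>)"
      using \<M>(1) that eY by (auto simp: matching_def pairwise_insert disjnt_def Y_def)
    ultimately show False using \<M>(2)[of "insert e \<M>"] fin\<M> by simp
  qed
  have "B \<subseteq> (\<Union>y\<in>Y. {e \<in> B. y \<in> e})" using cover by blast
  then have "card B \<le> card (\<Union>y\<in>Y. {e \<in> B. y \<in> e})" using finY finB by (intro card_mono) auto
  also have "\<dots> \<le> (\<Sum>y\<in>Y. card {e \<in> B. y \<in> e})" using finY by (rule card_UN_le)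
  finally have "real (card B) \<le> real (\<Sum>y\<in>Y. card {e \<in> B. y \<in> e})" by (rule of_nat_mono)
  also have "\<dots> = (\<Sum>y\<in>Y. real (card {e \<in> B. y \<in> e}))" by simp
  also have "\<dots> \<le> (\<Sum>y\<in>Y. 3 * (real n ^ 3 / 10000))"
  proof (rule sum_mono)
    fix y assume "y \<in> Y"
    then have y: "y \<in> V" "\<not> rich V E A y" using YW by (auto simp: W_def L_def)
    have "card {e \<in> B. y \<in> e} \<le> card {e \<in> E. y \<in> e \<and> card (e \<inter> A) \<noteq> 2}"
      using finE by (intro card_mono) (auto simp: B_def)
    then have "real (card {e \<in> B. y \<in> e}) \<le> real (card {e \<in> E. y \<in> e \<and> card (e \<inter> A) \<noteq> 2})" by simp
    then show "real (card {e \<in> B. y \<in> e}) \<le> 3 * (real n ^ 3 / 10000)"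
      using bad_degree_le[OF A(2) y] by linarith
  qed
  also have "\<dots> = real (card Y) * (3 * (real n ^ 3 / 10000))" by simp
  also have "\<dots> \<le> (real (card Z) + 4 * real s) * (3 * (real n ^ 3 / 10000))"
  proof (rule mult_right_mono)
    have "real (card Y) \<le> real (card Z + 4 * s)" using cY by (rule of_nat_mono)
    then show "real (card Y) \<le> real (card Z) + 4 * real s" by simp
  qed simp
  finally have cB: "real (card B) \<le> (real (card Z) + 4 * real s) * (3 * (real n ^ 3 / 10000))" .
  \<comment> \<open>Dividing the threshold 24 by the four vertices of a set gives 6 missing sets per
    vertex of \<open>Z\<close>, in units of \<open>n^3 / 10000\<close>. This is twice the bound 3 on
    the bad degree.\<close>
  have cM: "real (card M) \<ge> real (card Z) * (6 * (real n ^ 3 / 10000))"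
  proof -
    have "M \<subseteq> nset W 4" by (auto simp: M_def missing_def)
    then have "(\<Sum>z\<in>Z. card {m \<in> M. z \<in> m}) \<le> 4 * card M" by (rule sum_star_le[OF finW _ finZ])
    then have "real (\<Sum>z\<in>Z. card {m \<in> M. z \<in> m}) \<le> real (4 * card M)" by (rule of_nat_mono)
    moreover have "(\<Sum>z\<in>Z. real (card {m \<in> M. z \<in> m})) \<ge> (\<Sum>z\<in>Z. 24 / 10000 * real n ^ 3)"
      by (rule sum_mono) (auto simp: Z_def)
    ultimately show ?thesis by simp
  qed
  define TL where "TL = {e \<in> nset V 4. e \<inter> L \<noteq> {}}"
  define C where "C = {e \<in> nset W 4. card (e \<inter> A) = 2}"
  have finTC: "finite TL" "finite C" using V finW by (auto simp: TL_def C_def)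
  have MC: "M \<subseteq> C" by (auto simp: M_def C_def missing_def)
  have Esub: "E \<subseteq> TL \<union> (C - M) \<union> B"
    using E by (auto simp: TL_def C_def M_def missing_def B_def W_def nset_def)
  have "card E \<le> card (TL \<union> (C - M) \<union> B)" using Esub finTC finB by (intro card_mono) auto
  also have "\<dots> \<le> card TL + card (C - M) + card B"
    by (meson add_le_mono card_Un_le le_refl order_trans)
  also have "card (C - M) = card C - card M" using MC finM by (rule card_Diff_subset[rotated])
  finally have "card E + card M \<le> card TL + card C + card B"
    using card_mono[OF finTC(2) MC] by linarith
  then have up: "real (card E) + real (card M) \<le> real (card TL) + real (card C) + real (card B)"
    by (metis (mono_tags, lifting) of_nat_add of_nat_mono)
  have AL: "real (card (A - L)) \<ge> 44 / 100 * real n"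
  proof -
    have "card A \<le> card (A - L) + card L"
      using finite_subset[OF AV V] finL card_Un_le[of "A - L" L] card_mono[of "(A - L) \<union> L" A]
      by (metis Un_Diff_cancel2 Un_upper1 finite_UnI finite_Diff order_trans)
    then have "real (card A) \<le> real (card (A - L)) + real (card L)" by (metis of_nat_add of_nat_mono)
    moreover have "real (card L) \<le> real t" using Lt by simp
    ultimately show ?thesis using cA tn nlarge by simp
  qed
  have "real s \<le> real t" by (simp add: s_def)
  then have "real s \<le> real (card (A - L))" using AL tn nlarge by simp
  then have "s \<le> card (A - L)" by simp
  then obtain S where S: "S \<subseteq> A - L" "card S = s" using obtain_subset_with_card_n by metis
  have finS: "finite S" using S AV V by (meson Diff_subset finite_subset)
  have finAL: "finite (A - L)" using finite_subset[OF AV V] by simp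
  \<comment> \<open>These sets lie inside \<open>A - L\<close>, so they are neither in
    \<open>TL\<close> nor in \<open>C\<close>; exactly one vertex in \<open>S\<close> makes their
    number \<open>s\<close> times a binomial coefficient.\<close>
  define X where "X = {e \<in> nset (A - L) 4. card (e \<inter> S) = 1}"
  have finX: "finite X" using finAL by (simp add: X_def)
  have cX: "real (card X) \<ge> real s * (real n ^ 3 / 200)"
  proof -
    define r where "r = card (A - L - S)"
    have "card (A - L - S) = card (A - L) - s" using S finS by (simp add: card_Diff_subset)
    then have "real r \<ge> real (card (A - L)) - real s" by (simp add: r_def)
    then have r: "real r \<ge> 43 / 100 * real n" using AL \<open>real s \<le> real t\<close> tn nlarge by simp
    have "r \<le> card V" unfolding r_def using AV V by (intro card_mono) auto
    then have r2: "real r \<le> real n" by (simp add: n_def)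
    have "real (r choose 3) \<ge> real r ^ 3 / 6 - real r ^ 2 / 2" by (rule choose3_ge)
    moreover have "real r ^ 3 \<ge> (43 / 100 * real n) ^ 3" using r by (intro power_mono) auto
    moreover have "real r ^ 2 \<le> real n ^ 2" using r2 by (intro power_mono) auto
    moreover have "1000000 * real n ^ 2 \<le> real n * real n ^ 2" using nlarge by (intro mult_right_mono) auto
    moreover have "real n * real n ^ 2 = real n ^ 3" by (simp add: eval_nat_numeral)
    moreover have "(43 / 100 * real n) ^ 3 = 79507 / 1000000 * real n ^ 3" by (simp add: eval_nat_numeral)
    ultimately have "real (r choose 3) \<ge> real n ^ 3 / 200" using n3 by linarith
    moreover have "card X = s * (r choose 3)"
      using card_nset_split[OF finAL S(1), of 1 4] S(2) by (simp add: X_def r_def)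
    ultimately show ?thesis
      using mult_left_mono[of "real n ^ 3 / 200" "real (r choose 3)" "real s"] by simp
  qed
  have SL: "S \<inter> L = {}" using S by auto
  \<comment> \<open>The competitor: replacing \<open>L\<close> by a \<open>t\<close>-set gains the sets of \<open>X\<close>, a positive proportion of \<open>s n\<^sup>3\<close>,
    whereas the bad edges exceed the missing sets by a much smaller amount.\<close>
  define J where "J = join_sets V (L \<union> S) A"
  have J4: "J \<subseteq> nset V 4" by (auto simp: J_def join_sets_def)
  have cLS: "card (L \<union> S) = t" using card_Un_disjoint[OF finL finS] SL S(2) Lt by (auto simp: s_def)
  have "\<not> packing J (t + 1)"
    using join_sets_no_packing[of "L \<union> S" V A] finL finS cLS by (simp add: J_def)
  then have JE: "card J \<le> card E" by (rule max[OF J4])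
  have sub: "TL \<union> C \<union> X \<subseteq> J"
  proof -
    have "X \<subseteq> J"
    proof
      fix e assume "e \<in> X"
      then have "e \<in> nset V 4" "e \<inter> S \<noteq> {}" using AV by (auto simp: X_def nset_def)
      then show "e \<in> J" by (auto simp: J_def join_sets_def)
    qed
    moreover have "TL \<subseteq> J" by (auto simp: TL_def J_def join_sets_def)
    moreover have "C \<subseteq> J" by (auto simp: C_def J_def join_sets_def nset_def W_def)
    ultimately show ?thesis by blast
  qed
  have "TL \<inter> C = {}" by (auto simp: TL_def C_def W_def nset_def)
  moreover have "(TL \<union> C) \<inter> X = {}"
  proof -
    have "e \<inter> A = e" if "e \<in> X" for e using that by (auto simp: X_def nset_def)
    then show ?thesis by (fastforce simp: TL_def C_def X_def nset_def)
  qed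
  ultimately have cJ: "card (TL \<union> C \<union> X) = card TL + card C + card X"
    using finTC finX by (simp add: card_Un_disjoint)
  have "card (TL \<union> C \<union> X) \<le> card J"
    using sub V J4 by (intro card_mono) (auto intro: finite_subset)
  then have "card TL + card C + card X \<le> card E" using cJ JE by linarith
  then have "real (card TL) + real (card C) + real (card X) \<le> real (card E)"
    by (metis (mono_tags, lifting) of_nat_add of_nat_mono)
  then have bal: "real (card X) + real (card M) \<le> real (card B)" using up by linarith
  define N where "N = real n ^ 3 / 10000"
  have N: "N > 0" using n3 by (simp add: N_def)
  \<comment> \<open>In units of \<open>N\<close>, each vertex of \<open>S\<close> gains 50 against
    at most 4 times 3 for the vertices of a matching edge, and each vertex of \<open>Z\<close> costs
    6 against 3. The surplus is 38 and 3.\<close>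
  have "real s * (50 * N) + real (card Z) * (6 * N) \<le> (real (card Z) + 4 * real s) * (3 * N)"
    using bal cX cM cB unfolding N_def by simp
  then have "N * (38 * real s + 3 * real (card Z)) \<le> 0" by (simp add: algebra_simps)
  then have "38 * real s + 3 * real (card Z) \<le> 0" using N by (simp add: mult_le_0_iff)
  then have s0: "s = 0" and Z0: "card Z = 0" by simp_all
  then have "real (card B) \<le> 0" using cB by simp
  then have B0: "B = {}" using finB by simp
  have "real (card M) \<le> 0" using bal \<open>real (card B) \<le> 0\<close> by linarith
  then have M0: "M = {}" using finM by simp
  \<comment> \<open>With no bad edges left, \<open>E\<close> lies in a set that is not larger than
    \<open>E\<close>, so the two coincide.\<close>
  have "E \<subseteq> TL \<union> C" using Esub B0 M0 by simp
  moreover have "card (TL \<union> C) \<le> card E"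
    using \<open>card TL + card C + card X \<le> card E\<close> card_Un_le[of TL C] by linarith
  ultimately have "E = TL \<union> C" using finTC by (intro card_seteq) auto
  also have "\<dots> = join_sets V L (A - L)"
  proof -
    have "e \<in> C \<longleftrightarrow> card (e \<inter> (A - L)) = 2" if "e \<in> nset V 4" "e \<inter> L = {}" for e
    proof -
      have "e \<inter> (A - L) = e \<inter> A" "e \<in> nset W 4" using that by (auto simp: nset_def W_def)
      then show ?thesis by (simp add: C_def)
    qed
    moreover have "e \<in> nset V 4 \<and> e \<inter> L = {}" if "e \<in> C" for e
      using that by (auto simp: C_def nset_def W_def)
    ultimately show ?thesis unfolding TL_def join_sets_def by blast
  qed
  finally have "E = join_sets V L (A - L)" .
  moreover have "card L = t" using s0 Lt by (simp add: s_def)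
  moreover have "A - L \<subseteq> V - L" using AV by auto
  ultimately show ?thesis using LV by blast
qed

section \<open>Hypergraphs and isomorphism\<close>

lemma F7_verts: "verts F7 = {1, 2, 3, 4, 5, 6, 7}"
  by (auto simp: F7_def)

lemma F7_edges: "edges F7 = {{1, 2, 3, 4}, {1, 2, 3, 5}, {1, 2, 3, 6}, {4, 5, 6, 7}}"
  by (simp add: F7_def)

lemma F7_on_of_copy:
  assumes "is_copy_in F7 G C"
  shows "F7_on (edges G) (verts C)"
proof -
  obtain f where f: "bij_betw f {1, 2, 3, 4, 5, 6, 7} (verts C)" "edges C = (\<lambda>e. f ` e) ` edges F7"
    and CG: "edges C \<subseteq> edges G"
    using assms unfolding is_copy_in_def hg_iso_def F7_verts by blast
  have inj: "inj_on f {1, 2, 3, 4, 5, 6, 7}" and im: "verts C = f ` {1, 2, 3, 4, 5, 6, 7}"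
    using f(1) by (auto simp: bij_betw_def)
  have ed: "f ` e \<in> edges G" if "e \<in> edges F7" for e using f(2) CG that by auto
  have "F7_on (edges G) (insert (f 7) ({f 1, f 2, f 3} \<union> {f 4, f 5, f 6}))"
  proof (rule F7_onI)
    have [simp]: "f i = f j \<longleftrightarrow> i = j" if "i \<in> {1, 2, 3, 4, 5, 6, 7}" "j \<in> {1, 2, 3, 4, 5, 6, 7}" for i j
      using inj that by (rule inj_on_eq_iff)
    show "card {f 1, f 2, f 3} = 3" "card {f 4, f 5, f 6} = 3" by simp_all
    show "f 7 \<notin> {f 1, f 2, f 3}" "f 7 \<notin> {f 4, f 5, f 6}" by simp_all
    have "insert (f i) {f 1, f 2, f 3} \<in> edges G" if "i \<in> {4, 5, 6}" for i
    proof -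
      have "{1, 2, 3, i} \<in> edges F7" using that by (auto simp: F7_edges)
      from ed[OF this] show ?thesis by (simp add: insert_commute)
    qed
    then show "{f 4, f 5, f 6} \<subseteq> nbr (edges G) {f 1, f 2, f 3}" by (simp add: nbr_def)
    have "{4, 5, 6, 7} \<in> edges F7" by (simp add: F7_edges)
    from ed[OF this] show "insert (f 7) {f 4, f 5, f 6} \<in> edges G" by (simp add: insert_commute)
  qed
  moreover have "insert (f 7) ({f 1, f 2, f 3} \<union> {f 4, f 5, f 6}) = verts C" unfolding im by auto
  ultimately show ?thesis by simp
qed

lemma copy_of_F7_on:
  assumes G: "edges G \<subseteq> nset (verts G) 4" and X: "F7_on (edges G) X"
  shows "\<exists>C. is_copy_in F7 G C \<and> verts C = X"
proof -
  obtain T D w where *: "card T = 3" "card D = 3" "D \<subseteq> nbr (edges G) T" "w \<notin> T" "w \<notin> D"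
    "insert w D \<in> edges G" "X = insert w (T \<union> D)"
    using X unfolding F7_on_def by blast
  obtain x1 x2 x3 where T: "T = {x1, x2, x3}" "x1 \<noteq> x2" "x2 \<noteq> x3" "x1 \<noteq> x3"
    using *(1) unfolding card_3_iff by auto
  obtain x4 x5 x6 where D: "D = {x4, x5, x6}" "x4 \<noteq> x5" "x5 \<noteq> x6" "x4 \<noteq> x6"
    using *(2) unfolding card_3_iff by auto
  have TD: "x4 \<notin> T" "x5 \<notin> T" "x6 \<notin> T" using *(3) D by (auto simp: nbr_def)
  \<comment> \<open>The default value \<open>w\<close> is the image of 7.\<close>
  define f :: "nat \<Rightarrow> 'a" where "f = (\<lambda>_. w)(1 := x1, 2 := x2, 3 := x3, 4 := x4, 5 := x5, 6 := x6)"
  have f: "f 1 = x1" "f (Suc 0) = x1" "f 2 = x2" "f 3 = x3" "f 4 = x4" "f 5 = x5" "f 6 = x6" "f 7 = w"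
    by (simp_all add: f_def)
  define C where "C = \<lparr>verts = X, edges = (\<lambda>e. f ` e) ` edges F7\<rparr>"
  have "inj_on f {1, 2, 3, 4, 5, 6, 7}"
    using T D TD *(4,5) by (simp add: f) auto
  moreover have "f ` {1, 2, 3, 4, 5, 6, 7} = X" using *(7) T D by (auto simp: f)
  ultimately have "bij_betw f (verts F7) (verts C)" by (simp add: bij_betw_def F7_verts C_def)
  then have "F7 \<cong>\<^sub>h C" unfolding hg_iso_def by (intro exI[of _ f]) (simp add: C_def)
  moreover have "edges C = {insert x4 T, insert x5 T, insert x6 T, insert w D}"
    by (simp add: C_def F7_edges f T D insert_commute)
  then have "edges C \<subseteq> edges G" using *(3,6) D by (auto simp: nbr_def)
  moreover have "verts C \<subseteq> verts G" using F7_on_subset[OF X G] by (simp add: C_def)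
  ultimately show ?thesis unfolding is_copy_in_def by (intro exI[of _ C]) (simp add: C_def)
qed

text \<open>Vertex sets of copies are nonempty, so a disjoint family indexed by
  \<open>{..<k}\<close> is injective and yields \<open>k\<close> distinct sets; conversely an
  enumeration of a packing yields the family.\<close>

lemma has_disjoint_copies_iff:
  assumes G: "edges G \<subseteq> nset (verts G) 4"
  shows "has_disjoint_copies k F7 G \<longleftrightarrow> packing (edges G) k"
proof
  assume "has_disjoint_copies k F7 G"
  then obtain C where C: "\<And>i. i < k \<Longrightarrow> is_copy_in F7 G (C i)"
    and dj: "disjoint_family_on (\<lambda>i. verts (C i)) {..<k}"
    unfolding has_disjoint_copies_def by blast
  have F7_onC: "F7_on (edges G) (verts (C i))" if "i < k" for i using F7_on_of_copy[OF C[OF that]] .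
  have "inj_on (\<lambda>i. verts (C i)) {..<k}"
  proof (rule inj_onI, rule ccontr)
    fix i j assume ij: "i \<in> {..<k}" "j \<in> {..<k}" "verts (C i) = verts (C j)" "i \<noteq> j"
    then have "verts (C i) \<inter> verts (C j) = {}" using dj unfolding disjoint_family_on_def by blast
    then show False using ij F7_on_finite[OF F7_onC[of i]] by auto
  qed
  then have "card ((\<lambda>i. verts (C i)) ` {..<k}) = k" by (simp add: card_image)
  moreover have "pairwise disjnt ((\<lambda>i. verts (C i)) ` {..<k})"
  proof (rule pairwiseI)
    fix S S' assume S: "S \<in> (\<lambda>i. verts (C i)) ` {..<k}" "S' \<in> (\<lambda>i. verts (C i)) ` {..<k}" "S \<noteq> S'"
    then obtain i j where ij: "i \<in> {..<k}" "S = verts (C i)" "j \<in> {..<k}" "S' = verts (C j)" by auto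
    then have "i \<noteq> j" using S(3) by auto
    then have "verts (C i) \<inter> verts (C j) = {}" using dj ij(1,3) by (simp add: disjoint_family_on_def)
    then show "disjnt S S'" using ij by (simp add: disjnt_def)
  qed
  moreover have "\<forall>X\<in>(\<lambda>i. verts (C i)) ` {..<k}. F7_on (edges G) X" using F7_onC by simp
  ultimately show "packing (edges G) k" unfolding packing_def by blast
next
  assume "packing (edges G) k"
  then obtain \<X> where X: "finite \<X>" "card \<X> = k" "pairwise disjnt \<X>" "\<forall>X\<in>\<X>. F7_on (edges G) X"
    unfolding packing_def by blast
  obtain h where h: "bij_betw h {0..<k} \<X>" using ex_bij_betw_nat_finite[OF X(1)] X(2) by blast
  have "\<exists>C. is_copy_in F7 G C \<and> verts C = h i" if "i < k" for i
    using copy_of_F7_on[OF G] X(4) h that by (metis atLeastLessThan_iff bij_betwE le0)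
  then obtain C where C: "\<And>i. i < k \<Longrightarrow> is_copy_in F7 G (C i) \<and> verts (C i) = h i" by metis
  have "disjoint_family_on (\<lambda>i. verts (C i)) {..<k}"
    unfolding disjoint_family_on_def
  proof (intro ballI impI)
    fix i j assume ij: "i \<in> {..<k}" "j \<in> {..<k}" "i \<noteq> j"
    then have "h i \<noteq> h j" "h i \<in> \<X>" "h j \<in> \<X>" using h by (auto simp: bij_betw_def inj_on_def)
    then show "verts (C i) \<inter> verts (C j) = {}"
      using X(3) C ij by (auto simp: pairwise_def disjnt_def)
  qed
  then show "has_disjoint_copies k F7 G" unfolding has_disjoint_copies_def using C by blast
qed

section \<open>Isomorphism classes of 4-graphs\<close>

lemma four_graph_iff: "four_graph G \<longleftrightarrow> finite (verts G) \<and> edges G \<subseteq> nset (verts G) 4"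
  by (simp add: four_graph_def nset_def)

text \<open>The assumption on \<open>G\<close> places its edges inside the vertex set, where
  \<open>inv_into\<close> undoes \<open>f\<close>.\<close>

lemma hg_iso_sym:
  assumes G: "four_graph G" and iso: "G \<cong>\<^sub>h H"
  shows "H \<cong>\<^sub>h G"
proof -
  obtain f where f: "bij_betw f (verts G) (verts H)" "edges H = (\<lambda>e. f ` e) ` edges G"
    using iso unfolding hg_iso_def by blast
  let ?g = "inv_into (verts G) f"
  have "?g ` f ` e = e" if "e \<in> edges G" for e
    using that G f(1) by (intro inv_into_image_cancel) (auto simp: four_graph_def bij_betw_def)
  then have "edges G = (\<lambda>e. ?g ` e) ` edges H" using f(2) by (force simp: image_image)
  then show ?thesis unfolding hg_iso_def using bij_betw_inv_into[OF f(1)] by blast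
qed

lemma hg_iso_trans: "G \<cong>\<^sub>h H \<Longrightarrow> H \<cong>\<^sub>h I \<Longrightarrow> G \<cong>\<^sub>h I"
  unfolding hg_iso_def
proof (elim exE conjE)
  fix f g
  assume "bij_betw f (verts G) (verts H)" "edges H = (\<lambda>e. f ` e) ` edges G"
    "bij_betw g (verts H) (verts I)" "edges I = (\<lambda>e. g ` e) ` edges H"
  then show "\<exists>f. bij_betw f (verts G) (verts I) \<and> edges I = (\<lambda>e. f ` e) ` edges G"
    by (intro exI[of _ "g \<circ> f"]) (auto simp: image_image intro: bij_betw_trans)
qed

lemma iso_rel_class_eq:
  fixes G H :: "'a hypergraph"
  assumes "four_graph G" "four_graph H" "G \<cong>\<^sub>h H"
  shows "iso_rel `` {G} = iso_rel `` {H}"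
proof -
  have "G \<cong>\<^sub>h I \<longleftrightarrow> H \<cong>\<^sub>h I" for I :: "'a hypergraph"
    using assms hg_iso_sym[OF assms(1,3)] hg_iso_trans[of G H I] hg_iso_trans[of H G I] by blast
  then show ?thesis using assms by (simp add: iso_rel_def Image_def)
qed

lemma card_Diff_disjoint_pair:
  assumes "L \<subseteq> U" "R \<subseteq> U - L" "finite L" "finite R"
  shows "card (U - (L \<union> R)) = card U - (card L + card R)"
proof -
  have "L \<inter> R = {}" "L \<union> R \<subseteq> U" using assms by auto
  then show ?thesis using assms(3,4) by (simp add: card_Diff_subset card_Un_disjoint)
qed

text \<open>Bijections on \<open>K\<close>, on \<open>P\<close> and on the remaining vertices are
  glued; the result preserves the intersections that define an edge.\<close>

lemma join_sets_iso:
  assumes fin: "finite V" "finite V'" and sub: "K \<subseteq> V" "P \<subseteq> V - K" "K' \<subseteq> V'" "P' \<subseteq> V' - K'"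
    and cards: "card V = card V'" "card K = card K'" "card P = card P'"
    and G: "verts G = V" "edges G = join_sets V K P" and H: "verts H = V'" "edges H = join_sets V' K' P'"
  shows "G \<cong>\<^sub>h H"
proof -
  have finK: "finite K" "finite P" "finite K'" "finite P'" using fin sub finite_subset by blast+
  obtain a where a: "bij_betw a K K'" using finite_same_card_bij finK cards by blast
  obtain b where b: "bij_betw b P P'" using finite_same_card_bij finK cards by blast
  have "card (V - (K \<union> P)) = card V - (card K + card P)"
    using sub finK by (intro card_Diff_disjoint_pair) auto
  moreover have "card (V' - (K' \<union> P')) = card V' - (card K' + card P')"
    using sub finK by (intro card_Diff_disjoint_pair) auto
  ultimately obtain c where c: "bij_betw c (V - (K \<union> P)) (V' - (K' \<union> P'))"
    using finite_same_card_bij[of "V - (K \<union> P)" "V' - (K' \<union> P')"] fin cards by auto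
  define f where "f x = (if x \<in> K \<union> P then if x \<in> K then a x else b x else c x)" for x
  have fK: "f ` K = K'" using a by (auto simp: f_def bij_betw_def)
  have "f ` P = b ` P" using sub by (intro image_cong) (auto simp: f_def)
  then have fP: "f ` P = P'" using b by (simp add: bij_betw_def)
  have "bij_betw (\<lambda>x. if x \<in> K then a x else b x) (K \<union> P) (K' \<union> P')"
    using sub by (intro bij_betw_disjoint_Un[OF a b]) auto
  then have "bij_betw f ((K \<union> P) \<union> (V - (K \<union> P))) ((K' \<union> P') \<union> (V' - (K' \<union> P')))"
    unfolding f_def by (rule bij_betw_disjoint_Un[OF _ c]) auto
  moreover have "(K \<union> P) \<union> (V - (K \<union> P)) = V" "(K' \<union> P') \<union> (V' - (K' \<union> P')) = V'" using sub by auto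
  ultimately have f: "bij_betw f V V'" by simp
  have inj: "inj_on f V" and im: "f ` V = V'" using f by (auto simp: bij_betw_def)
  have PV: "P \<subseteq> V" using sub by blast
  have key: "f ` e \<in> join_sets V' K' P' \<longleftrightarrow> e \<in> join_sets V K P" if "e \<subseteq> V" for e
  proof -
    have "f ` e \<inter> K' = f ` (e \<inter> K)" "f ` e \<inter> P' = f ` (e \<inter> P)"
      using inj_on_image_Int[OF inj that] sub(1) PV fK fP by auto
    moreover have "card (f ` e) = card e" "card (f ` (e \<inter> P)) = card (e \<inter> P)"
      using inj that by (auto intro!: card_image intro: inj_on_subset)
    ultimately show ?thesis using that im by (auto simp: join_sets_def nset_def)
  qed
  have "join_sets V' K' P' = (\<lambda>e. f ` e) ` join_sets V K P"
  proof
    show "(\<lambda>e. f ` e) ` join_sets V K P \<subseteq> join_sets V' K' P'"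
      using key by (auto simp: join_sets_def nset_def)
    show "join_sets V' K' P' \<subseteq> (\<lambda>e. f ` e) ` join_sets V K P"
    proof
      fix e' assume e': "e' \<in> join_sets V' K' P'"
      then have "e' \<subseteq> f ` V" using im by (auto simp: join_sets_def nset_def)
      then obtain e where "e \<subseteq> V" "e' = f ` e" by (meson subset_image_iff)
      then show "e' \<in> (\<lambda>e. f ` e) ` join_sets V K P" using key e' by blast
    qed
  qed
  then show ?thesis unfolding hg_iso_def G H using f by blast
qed

text \<open>The first summand does not involve \<open>P\<close>, so optimizing \<open>P\<close>
  means maximizing the product of the two binomials.\<close>

lemma card_join_sets:
  assumes V: "finite V" and K: "K \<subseteq> V" and P: "P \<subseteq> V - K"
  shows "card (join_sets V K P) = card {e \<in> nset V 4. e \<inter> K \<noteq> {}}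
     + (card P choose 2) * ((card (V - K) - card P) choose 2)"
proof -
  have eq: "join_sets V K P = {e \<in> nset V 4. e \<inter> K \<noteq> {}} \<union> {e \<in> nset (V - K) 4. card (e \<inter> P) = 2}"
    by (auto simp: join_sets_def nset_def)
  have "finite P" using P V finite_subset by blast
  then have "card {e \<in> nset (V - K) 4. card (e \<inter> P) = 2} = (card P choose 2) * ((card (V - K) - card P) choose 2)"
    using card_nset_split[of "V - K" P 2 4] V P by (simp add: card_Diff_subset)
  moreover have "{e \<in> nset V 4. e \<inter> K \<noteq> {}} \<inter> {e \<in> nset (V - K) 4. card (e \<inter> P) = 2} = {}"
    by (auto simp: nset_def)
  ultimately show ?thesis unfolding eq using V by (simp add: card_Un_disjoint)
qed

text \<open>The 2-2 condition is symmetric. This is needed when the two optimal parts have different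
  sizes and the wrong one has been named \<open>P\<close>.\<close>

lemma join_sets_flip:
  assumes V: "finite V" and P: "P \<subseteq> V - K"
  shows "join_sets V K (V - K - P) = join_sets V K P"
proof -
  have "card (e \<inter> (V - K - P)) = 2 \<longleftrightarrow> card (e \<inter> P) = 2" if "e \<in> nset V 4" "e \<inter> K = {}" for e
  proof -
    have e: "finite e" "e \<subseteq> V - K" "card e = 4" using that nset_mem_finite[OF V, of e 4] by (auto simp: nset_def)
    then have "card (e \<inter> P) \<le> 4" by (metis card_mono inf_le1)
    then show ?thesis using card_compl_Int[OF e(1,2), of P] e(3) by auto
  qed
  then show ?thesis by (auto simp: join_sets_def)
qed

text \<open>Moving one vertex from the larger part to the smaller one increases the product by
  \<open>a * (b - 1) * (b - a - 1) / 2\<close>, which is positive.\<close>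

lemma choose2_prod_less:
  assumes "1 \<le> a" "a + 2 \<le> b"
  shows "(a choose 2) * (b choose 2) < (Suc a choose 2) * ((b - 1) choose 2)"
proof -
  define x y where "x = real a" and "y = real b"
  have "x * (y - 1) * (y - x - 1) > 0"
    using assms by (intro mult_pos_pos) (auto simp: x_def y_def)
  moreover have "((x + 1) * x / 2) * ((y - 1) * (y - 2) / 2) - (x * (x - 1) / 2) * (y * (y - 1) / 2)
     = x * (y - 1) * (y - x - 1) / 2"
    by (simp add: field_simps)
  ultimately have "(x * (x - 1) / 2) * (y * (y - 1) / 2) < ((x + 1) * x / 2) * ((y - 1) * (y - 2) / 2)"
    by argo
  moreover have eqs: "real (Suc a choose 2) = (x + 1) * x / 2" "real (a choose 2) = x * (x - 1) / 2"
    "real (b choose 2) = y * (y - 1) / 2" "real ((b - 1) choose 2) = (y - 1) * (y - 2) / 2"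
    using assms unfolding choose2 x_def y_def by (simp_all add: of_nat_diff add.commute)
  ultimately have "real (a choose 2) * real (b choose 2) < real (Suc a choose 2) * real ((b - 1) choose 2)"
    unfolding eqs by simp
  then show ?thesis by (metis of_nat_less_iff of_nat_mult)
qed

text \<open>From \<open>m = 4\<close> on the optimum is positive, so both parts have at least two
  vertices and \<open>choose2_prod_less\<close> excludes a difference of two or more. For smaller
  \<open>m\<close> every product vanishes.\<close>

lemma balanced_unique:
  assumes m: "4 \<le> m" and p: "p \<le> m"
    and opt: "\<And>p'. p' \<le> m \<Longrightarrow> (p' choose 2) * ((m - p') choose 2) \<le> (p choose 2) * ((m - p) choose 2)"
  shows "p = m div 2 \<or> p = m - m div 2"
proof -
  have "0 < (2 choose 2) * ((m - 2) choose 2)" using m by (simp add: zero_less_binomial_iff)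
  also have "\<dots> \<le> (p choose 2) * ((m - p) choose 2)" using m by (intro opt) simp
  finally have "0 < (p choose 2) * ((m - p) choose 2)" .
  then have "p choose 2 \<noteq> 0" "(m - p) choose 2 \<noteq> 0" by auto
  then have "2 \<le> p" "2 \<le> m - p" using binomial_eq_0[of _ 2] by (meson not_less)+
  moreover have "\<not> p + 2 \<le> m - p"
  proof
    assume "p + 2 \<le> m - p"
    then have "(p choose 2) * ((m - p) choose 2) < (Suc p choose 2) * ((m - p - 1) choose 2)"
      using \<open>2 \<le> p\<close> by (intro choose2_prod_less) auto
    moreover have "Suc p \<le> m" using \<open>2 \<le> m - p\<close> by linarith
    ultimately show False using opt[of "Suc p"] by simp
  qed
  moreover have "\<not> (m - p) + 2 \<le> p"
  proof
    assume "(m - p) + 2 \<le> p"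
    then have "((m - p) choose 2) * (p choose 2) < (Suc (m - p) choose 2) * ((p - 1) choose 2)"
      using \<open>2 \<le> m - p\<close> by (intro choose2_prod_less) auto
    moreover have "m - (p - 1) = Suc (m - p)" using p \<open>2 \<le> p\<close> by simp
    moreover have "p - 1 \<le> m" using p by linarith
    ultimately show False using opt[of "p - 1"] by (simp add: mult.commute)
  qed
  ultimately show ?thesis by linarith
qed

section \<open>The join with \<open>B4_even\<close> as a \<open>join_sets\<close> graph\<close>

lemma two_two_graph_edges:
  assumes W: "finite W" and P: "P \<subseteq> W"
  shows "edges (two_two_graph P (W - P)) = {e \<in> nset W 4. card (e \<inter> P) = 2}"
proof -
  have "card (e \<inter> P) = 2 \<and> card (e \<inter> (W - P)) = 2 \<longleftrightarrow> card e = 4 \<and> card (e \<inter> P) = 2" if "e \<subseteq> W" for e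
  proof -
    have "finite e" using that W finite_subset by blast
    moreover from this have "card (e \<inter> P) \<le> card e" by (simp add: card_mono)
    ultimately show ?thesis using card_compl_Int[of e W P] that by auto
  qed
  moreover have "P \<union> (W - P) = W" using P by auto
  ultimately show ?thesis by (auto simp: two_two_graph_def nset_def)
qed

lemma join4_edges:
  assumes W: "finite W" and P: "P \<subseteq> W" and KW: "K \<inter> W = {}"
  shows "edges (complete4 K \<bowtie> two_two_graph P (W - P)) = join_sets (K \<union> W) K P"
proof -
  have vW: "verts (two_two_graph P (W - P)) = W" using P by (auto simp: two_two_graph_def)
  have "edges (complete4 K \<bowtie> two_two_graph P (W - P)) = nset K 4 \<union> {e \<in> nset W 4. card (e \<inter> P) = 2}
      \<union> {e \<in> nset (K \<union> W) 4. e \<inter> K \<noteq> {} \<and> e \<inter> W \<noteq> {}}"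
    unfolding join4_def by (simp add: vW two_two_graph_edges[OF W P] complete4_def nset_def)
  also have "\<dots> = join_sets (K \<union> W) K P"
  proof (intro set_eqI)
    fix e
    have "e \<in> nset W 4 \<longleftrightarrow> e \<in> nset (K \<union> W) 4 \<and> e \<inter> K = {}"
      using KW by (auto simp: nset_def)
    moreover have "e \<in> nset K 4 \<longleftrightarrow> e \<in> nset (K \<union> W) 4 \<and> e \<inter> W = {}"
      using KW by (auto simp: nset_def)
    moreover have "e \<inter> K \<noteq> {}" if "e \<in> nset K 4" using that by (auto simp: nset_def Int_absorb2)
    ultimately show "e \<in> nset K 4 \<union> {e \<in> nset W 4. card (e \<inter> P) = 2}
        \<union> {e \<in> nset (K \<union> W) 4. e \<inter> K \<noteq> {} \<and> e \<inter> W \<noteq> {}} \<longleftrightarrow> e \<in> join_sets (K \<union> W) K P"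
      unfolding join_sets_def by blast
  qed
  finally show ?thesis .
qed

text \<open>Edge counts are bounded, so \<open>ARG_MAX\<close> attains a maximum. Subsets of every
  size exist, which turns optimality over sets into optimality over sizes.\<close>

lemma B4_even_optimal:
  assumes W: "finite W"
  obtains P where "P \<subseteq> W" "B4_even W = two_two_graph P (W - P)"
    "\<And>p. p \<le> card W \<Longrightarrow> (p choose 2) * ((card W - p) choose 2) \<le> (card P choose 2) * ((card W - card P) choose 2)"
proof -
  define f where "f = (\<lambda>A. card (edges (two_two_graph A (W - A))))"
  define P where "P = arg_max f (\<lambda>A. A \<subseteq> W)"
  have f: "f A = (card A choose 2) * ((card W - card A) choose 2)" if "A \<subseteq> W" for A
    using card_nset_split[OF W that, of 2 4] two_two_graph_edges[OF W that] that W finite_subset[OF that W]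
    by (simp add: f_def card_Diff_subset)
  have "f A < Suc (card (nset W 4))" if "A \<subseteq> W" for A
    using card_mono[of "nset W 4" "{e \<in> nset W 4. card (e \<inter> A) = 2}"] W two_two_graph_edges[OF W that]
    by (simp add: f_def less_Suc_eq_le)
  then have "P \<subseteq> W \<and> (\<forall>A. A \<subseteq> W \<longrightarrow> f A \<le> f P)"
    unfolding P_def by (intro arg_max_nat_lemma[of _ "{}" _ "Suc (card (nset W 4))"]) auto
  then have P: "P \<subseteq> W" and opt: "\<And>A. A \<subseteq> W \<Longrightarrow> f A \<le> f P" by auto
  show ?thesis
  proof (rule that[OF P])
    show "B4_even W = two_two_graph P (W - P)" by (simp add: B4_even_def P_def f_def Let_def)
    fix p assume "p \<le> card W"
    then obtain A where A: "A \<subseteq> W" "card A = p" using obtain_subset_with_card_n by metis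
    then show "(p choose 2) * ((card W - p) choose 2) \<le> (card P choose 2) * ((card W - card P) choose 2)"
      using opt[OF A(1)] f P by simp
  qed
qed

section \<open>Existence of a maximizer and uniqueness of its isomorphism class\<close>

theorem theorem2p11:
  shows "\<exists>(N0::nat) (c::real). c > 0 \<and>
    (\<forall>(n::nat) (t::nat). n \<ge> N0 \<and> real t \<le> c * real n \<longrightarrow>
      EX_classes n (t + 1) F7 = {iso_rel `` {complete4 {..<t} \<bowtie> B4_even {t..<n}}})"
proof (intro exI[of _ "10 ^ 27 :: nat"] exI[of _ "1 / 10 ^ 27 :: real"] conjI allI impI)
  show "(0 :: real) < 1 / 10 ^ 27" by simp
  fix n t :: nat
  assume nt: "10 ^ 27 \<le> n \<and> real t \<le> 1 / 10 ^ 27 * real n"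
  have n: "real n \<ge> 10 ^ 27" using nt by (metis of_nat_le_iff of_nat_numeral of_nat_power)
  have t: "10 ^ 27 * real t \<le> real n" using nt by simp
  have "10 * real t \<le> 10 ^ 27 * real t" "10 \<le> (10 :: real) ^ 27" by simp_all
  then have "10 * real t \<le> real n" "10 \<le> real n" using t n by (blast intro: order_trans)+
  \<comment> \<open>This provides the four vertices outside the \<open>t\<close>-set that
    \<open>balanced_unique\<close> requires.\<close>
  then have t4: "t + 4 \<le> n" by linarith
  define W where "W = {t..<n}"
  have W: "finite W" "card W = n - t" by (auto simp: W_def)
  obtain P0 where P0: "P0 \<subseteq> W" "B4_even W = two_two_graph P0 (W - P0)"
    "\<And>p. p \<le> card W \<Longrightarrow> (p choose 2) * ((card W - p) choose 2) \<le> (card P0 choose 2) * ((card W - card P0) choose 2)"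
    using B4_even_optimal[OF W(1)] by blast
  define H0 where "H0 = complete4 {..<t} \<bowtie> B4_even W"
  have KW: "{..<t} \<inter> W = {}" "{..<t} \<union> W = {..<n}" using t4 by (auto simp: W_def)
  have H0v: "verts H0 = {..<n}"
    using KW P0(1) by (auto simp: H0_def P0(2) join4_def complete4_def two_two_graph_def)
  have H0e: "edges H0 = join_sets {..<n} {..<t} P0"
    using join4_edges[OF W(1) P0(1) KW(1)] KW(2) by (simp add: H0_def P0(2))
  have H0: "four_graph H0" by (auto simp: four_graph_iff H0v H0e join_sets_def)
  define Q where "Q H \<longleftrightarrow> four_graph H \<and> card (verts H) = n \<and> \<not> has_disjoint_copies (t + 1) F7 H"
    for H :: "nat hypergraph"
  have QH0: "Q H0"
    using H0 H0v join_sets_no_packing[of "{..<t}" "{..<n}" P0] has_disjoint_copies_iff[of H0 "t + 1"]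
    by (simp add: Q_def four_graph_iff H0e)
  define \<G> where "\<G> = {G. is_arg_max (\<lambda>H. card (edges H)) Q G}"
  have iso: "iso_rel `` {G} = iso_rel `` {H0}" if "G \<in> \<G>" for G
  proof -
    define V where "V = verts G"
    have QG: "Q G" and opt: "\<And>H. Q H \<Longrightarrow> card (edges H) \<le> card (edges G)"
      using that by (auto simp: \<G>_def is_arg_max_def not_less)
    have G: "four_graph G" and V: "finite V" "card V = n" and GE: "edges G \<subseteq> nset V 4"
      using QG by (auto simp: Q_def four_graph_iff V_def)
    have np: "\<not> packing (edges G) (t + 1)"
      using QG GE has_disjoint_copies_iff[of G "t + 1"] by (simp add: Q_def V_def)
    have max: "card E' \<le> card (edges G)" if "E' \<subseteq> nset V 4" "\<not> packing E' (t + 1)" for E'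
    proof -
      have "Q \<lparr>verts = V, edges = E'\<rparr>"
        using that V has_disjoint_copies_iff[of "\<lparr>verts = V, edges = E'\<rparr>" "t + 1"]
        by (simp add: Q_def four_graph_iff)
      from opt[OF this] show ?thesis by simp
    qed
    obtain K P where K: "K \<subseteq> V" "card K = t" and P: "P \<subseteq> V - K" and E: "edges G = join_sets V K P"
      using extremal_structure[OF V(1) GE np max] n t V(2) by auto
    have finK: "finite K" using K V finite_subset by blast
    have cVK: "card (V - K) = n - t" using K finK V by (simp add: card_Diff_subset)
    have finVK: "finite (V - K)" using V by simp
    have "(p choose 2) * ((n - t - p) choose 2) \<le> (card P choose 2) * ((n - t - card P) choose 2)"
      if pn: "p \<le> n - t" for p
    proof -
      obtain P' where P': "P' \<subseteq> V - K" "card P' = p"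
        using pn cVK obtain_subset_with_card_n[of p "V - K"] by auto
      have "card (join_sets V K P') \<le> card (edges G)"
        using join_sets_no_packing[OF finK, of V P'] K by (intro max) (auto simp: join_sets_def)
      then show ?thesis
        unfolding E card_join_sets[OF V(1) K(1) P'(1)] card_join_sets[OF V(1) K(1) P] P'(2) cVK
        by (simp only: add_le_cancel_left)
    qed
    moreover have cP: "card P \<le> n - t" using card_mono[OF finVK P] cVK by simp
    ultimately have p: "card P = (n - t) div 2 \<or> card P = n - t - (n - t) div 2"
      using t4 by (intro balanced_unique) auto
    have cP0: "card P0 \<le> n - t" using card_mono[OF W(1) P0(1)] W(2) by simp
    have "card P0 = (n - t) div 2 \<or> card P0 = n - t - (n - t) div 2"
      using t4 cP0 P0(3) W(2) by (intro balanced_unique) auto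
    \<comment> \<open>For odd \<open>n - t\<close> the sets \<open>P\<close> and \<open>P0\<close>
      may be halves of different size; then the complement of \<open>P\<close> is used.\<close>
    then have "card P = card P0 \<or> n - t - card P = card P0" using p by auto
    then obtain P1 where P1: "P1 \<subseteq> V - K" "card P1 = card P0" "edges G = join_sets V K P1"
    proof
      assume "card P = card P0"
      then show ?thesis using that P E by blast
    next
      assume "n - t - card P = card P0"
      then have "card (V - K - P) = card P0"
        using cVK P finite_subset[OF P finVK] by (simp add: card_Diff_subset)
      then show ?thesis using that[of "V - K - P"] join_sets_flip[OF V(1) P] E by auto
    qed
    have "G \<cong>\<^sub>h H0"
    proof (rule join_sets_iso[OF V(1) _ K(1) P1(1)])
      show "{..<t} \<subseteq> {..<n}" "P0 \<subseteq> {..<n} - {..<t}" using t4 P0(1) by (auto simp: W_def)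
    qed (use V K P1 H0v H0e V_def in auto)
    then show ?thesis by (rule iso_rel_class_eq[OF G H0])
  qed
  \<comment> \<open>The bound yields a maximizer; without one the quotient would be empty instead of
    a singleton.\<close>
  have "card (edges H) < Suc (n choose 4)" if "Q H" for H
    using that card_mono[of "nset (verts H) 4" "edges H"]
    by (auto simp: Q_def four_graph_iff card_nset less_Suc_eq_le)
  then obtain G where "Q G" "\<And>H. Q H \<Longrightarrow> card (edges H) \<le> card (edges G)"
    using ex_has_greatest_nat[of Q H0 "\<lambda>H. card (edges H)" "Suc (n choose 4)"] QH0 by blast
  then have "G \<in> \<G>" by (auto simp: \<G>_def is_arg_max_def not_less)
  then have "\<G> // iso_rel = {iso_rel `` {H0}}" using iso by (auto simp: quotient_def)
  then show "EX_classes n (t + 1) F7 = {iso_rel `` {complete4 {..<t} \<bowtie> B4_even {t..<n}}}"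
    by (simp add: EX_classes_def \<G>_def Q_def[abs_def] H0_def W_def)
qed

end
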